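(* Let $n$ and $k$ be positive integers with $n\ge 2k+2$, and let $\varphi(n,k)$ denote the maximum size of a nontraceable graph of order $n$ and connectivity $k$. Then $$ \varphi(n,k)=\begin{cases} \binom{n-k-1}{2}+k(k+1) & \text{if } n \text{ is odd and } n\ge 6k-3, \text{ or } n \text{ is even and } n\ge 6k,\\[2pt] \frac{3n^2-12n+17}{8}+k & \text{if } n \text{ is odd and } 2k+3\le n\le 6k-5,\\[2pt] \frac{3n^2-10n+8}{8}+k & \text{if } n \text{ is even and } 2k+2\le n\le 6k-2. \end{cases} $$ Moreover, the extremal graphs (the nontraceable graphs of order $n$ and connectivity $k$ whose size is $\varphi(n,k)$) are, up to isomorphism, as follows. (i) If $n=6k-3$, then $\varphi(n,k)$ is attained by a graph $G$ if and only if $G=K_k\vee(K_{n-2k-1}+\overline{K_{k+1}})$ or $G=H_1(n,k)$. (ii) If $n=6k$, then $\varphi(n,k)$ is attained by a graph $G$ if and only if $G=K_k\vee(K_{n-2k-1}+\overline{K_{k+1}})$ or $G=H_2(n,k)$. (iii) If $n$ is odd and $n\ge 6k-1$, or $n$ is even and $n\ge 6k+2$, then $\varphi(n,k)$ is attained by a graph $G$ if and only if $G=K_k\vee(K_{n-2k-1}+\overline{K_{k+1}})$. (iv) If $n$ is odd and $2k+3\le n\le 6k-5$, then $\varphi(n,k)$ is attained by a graph $G$ if and only if $G=H_1(n,k)$. (v) If $n$ is even and $2k+2\le n\le 6k-2$, then $\varphi(n,k)$ is attained by a graph $G$ if and only if $G=H_2(n,k)$.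
   Context: All graphs are finite and simple. The order of a graph is its number of vertices and its size is its number of edges. Equality of graphs means isomorphism. The connectivity of a graph is its vertex connectivity $\kappa$ (with $\kappa(K_n)=n-1$). $K_n$ is the complete graph of order $n$, $\overline{G}$ is the complement of $G$, $G+H$ is the disjoint union of $G$ and $H$, and $G\vee H$ is the join, obtained from $G+H$ by adding all edges between $V(G)$ and $V(H)$. A graph is traceable if it contains a Hamilton path (a path through all its vertices), and nontraceable otherwise. For positive integers $n,k$ with $n$ odd and $n\ge 2k+3$, $H_1(n,k)$ denotes the graph obtained from $K_{(n-3)/2}\vee(K_2+\overline{K_{(n-1)/2}})$ by deleting $(n-3)/2-k$ edges that are incident to one common vertex in $\overline{K_{(n-1)/2}}$. For positive integers $n,k$ with $n$ even and $n\ge 2k+2$, $H_2(n,k)$ denotes the graph obtained from $K_{(n-2)/2}\vee\overline{K_{(n+2)/2}}$ by deleting $(n-2)/2-k$ edges that are incident to one common vertex in $\overline{K_{(n+2)/2}}$. *)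

theory Defs
  imports Complex_Main "Graph_Theory.Graph_Theory"
begin

text \<open>
  A finite simple graph is a finite irreflexive symmetric relation, i.e. a \<^locale>\<open>pair_graph\<close>;
  every undirected edge is therefore represented by two opposite arcs, and the size has to be
  counted with two-element sets.
\<close>

definition edges :: "'a pair_pre_digraph \<Rightarrow> 'a set set" where
  "edges G = {{u, v} | u v. (u, v) \<in> parcs G}"

definition graph_order :: "'a pair_pre_digraph \<Rightarrow> nat" where
  "graph_order G = card (pverts G)"

definition graph_size :: "'a pair_pre_digraph \<Rightarrow> nat" where
  "graph_size G = card (edges G)"

definition graph_iso :: "'a pair_pre_digraph \<Rightarrow> 'b pair_pre_digraph \<Rightarrow> bool" where
  "graph_iso G H \<longleftrightarrow> digraph_iso (with_proj G) (with_proj H)"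

definition traceable :: "'a pair_pre_digraph \<Rightarrow> bool" where
  "traceable G \<longleftrightarrow> (\<exists>p. vpath p (with_proj G) \<and> set p = pverts G)"

text \<open>
  The alternative of leaving a single vertex gives complete graphs, which have no vertex cut,
  their conventional connectivity; see \<open>vertex_connectivity_complete_graph\<close> below.
\<close>

definition vertex_connectivity :: "'a pair_pre_digraph \<Rightarrow> nat" where
  "vertex_connectivity G =
    (LEAST m. \<exists>S \<subseteq> pverts G. card S = m \<and>
      (\<not> connected (with_proj G \<restriction> (pverts G - S)) \<or> card (pverts G - S) = 1))"

definition complete_graph :: "nat \<Rightarrow> nat pair_pre_digraph" where
  "complete_graph n =
    \<lparr> pverts = {..<n}, parcs = {(u, v). u < n \<and> v < n \<and> u \<noteq> v} \<rparr>"

definition graph_complement :: "'a pair_pre_digraph \<Rightarrow> 'a pair_pre_digraph" where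
  "graph_complement G =
    \<lparr> pverts = pverts G,
      parcs = {(u, v). u \<in> pverts G \<and> v \<in> pverts G \<and> u \<noteq> v \<and> (u, v) \<notin> parcs G} \<rparr>"

definition disjoint_union ::
    "'a pair_pre_digraph \<Rightarrow> 'b pair_pre_digraph \<Rightarrow> ('a + 'b) pair_pre_digraph" where
  "disjoint_union G H =
    \<lparr> pverts = pverts G <+> pverts H,
      parcs = map_prod Inl Inl ` parcs G \<union> map_prod Inr Inr ` parcs H \<rparr>"

definition graph_join ::
    "'a pair_pre_digraph \<Rightarrow> 'b pair_pre_digraph \<Rightarrow> ('a + 'b) pair_pre_digraph" where
  "graph_join G H =
    \<lparr> pverts = pverts (disjoint_union G H),
      parcs = parcs (disjoint_union G H)
        \<union> (Inl ` pverts G) \<times> (Inr ` pverts H) \<union> (Inr ` pverts H) \<times> (Inl ` pverts G) \<rparr>"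

definition delete_edges :: "'a pair_pre_digraph \<Rightarrow> 'a set set \<Rightarrow> 'a pair_pre_digraph" where
  "delete_edges G D = \<lparr> pverts = pverts G, parcs = {(u, v) \<in> parcs G. {u, v} \<notin> D} \<rparr>"

text \<open>All graphs obtained from \<open>G\<close> by deleting \<open>d\<close> edges incident to one common vertex in \<open>W\<close>.\<close>

definition star_deletions ::
    "'a pair_pre_digraph \<Rightarrow> 'a set \<Rightarrow> nat \<Rightarrow> 'a pair_pre_digraph set" where
  "star_deletions G W d =
    {delete_edges G D | w D. w \<in> W \<and> D \<subseteq> {e \<in> edges G. w \<in> e} \<and> card D = d}"

definition split_clique_graph :: "nat \<Rightarrow> nat \<Rightarrow> (nat + nat + nat) pair_pre_digraph" where
  "split_clique_graph n k =
    graph_join (complete_graph k)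
      (disjoint_union (complete_graph (n - 2 * k - 1)) (graph_complement (complete_graph (k + 1))))"

text \<open>
  \<open>H1 n k\<close> and \<open>H2 n k\<close> collect the results of all admissible choices of the deleted edges.
  By symmetry the members of each of these sets are isomorphic to one another.
\<close>

definition H1 :: "nat \<Rightarrow> nat \<Rightarrow> (nat + nat + nat) pair_pre_digraph set" where
  "H1 n k =
    star_deletions
      (graph_join (complete_graph ((n - 3) div 2))
        (disjoint_union (complete_graph 2) (graph_complement (complete_graph ((n - 1) div 2)))))
      (Inr ` Inr ` {..<(n - 1) div 2})
      ((n - 3) div 2 - k)"

definition H2 :: "nat \<Rightarrow> nat \<Rightarrow> (nat + nat) pair_pre_digraph set" where
  "H2 n k =
    star_deletions
      (graph_join (complete_graph ((n - 2) div 2))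
        (graph_complement (complete_graph ((n + 2) div 2))))
      (Inr ` {..<(n + 2) div 2})
      ((n - 2) div 2 - k)"

definition nontraceable_graph :: "nat \<Rightarrow> nat \<Rightarrow> 'a pair_pre_digraph \<Rightarrow> bool" where
  "nontraceable_graph n k G \<longleftrightarrow>
    pair_graph G \<and> graph_order G = n \<and> vertex_connectivity G = k \<and> \<not> traceable G"

text \<open>
  Every finite graph is isomorphic to one with vertices in \<^typ>\<open>nat\<close>, so maximising over these is
  maximising over all finite graphs.
\<close>

definition phi :: "nat \<Rightarrow> nat \<Rightarrow> nat" where
  "phi n k = Max {graph_size G | G :: nat pair_pre_digraph. nontraceable_graph n k G}"

definition phi_attained_by :: "nat \<Rightarrow> nat \<Rightarrow> 'a pair_pre_digraph \<Rightarrow> bool" where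
  "phi_attained_by n k G \<longleftrightarrow> nontraceable_graph n k G \<and> graph_size G = phi n k"

lemma complete_digraph_complete_graph: "K\<^bsub>n\<^esub> (with_proj (complete_graph n))"
  by (auto simp: complete_digraph_pair_def complete_graph_def)

lemma vertex_connectivity_complete_graph:
  assumes "n \<ge> 1"
  shows "vertex_connectivity (complete_graph n) = n - 1"
proof -
  have conn: "connected (with_proj (complete_graph n) \<restriction> T)"
    if "T \<subseteq> {..<n}" "T \<noteq> {}" for T
  proof -
    let ?M = "mk_symmetric (with_proj (complete_graph n) \<restriction> T)"
    have "(u, v) \<in> rtrancl_on (pverts ?M) (parcs ?M)" if "u \<in> T" "v \<in> T" for u v
    proof (cases "u = v")
      case True
      then show ?thesis using that by (auto simp: mk_symmetric_def)
    next
      case False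
      then have "(u, v) \<in> parcs ?M"
        using that \<open>T \<subseteq> {..<n}\<close>
        by (auto simp: mk_symmetric_def induce_subgraph_def complete_graph_def with_proj_def)
      then show ?thesis
        using that rtrancl_on_into_rtrancl_on[OF rtrancl_on_refl, of u "pverts ?M" v "parcs ?M"]
        by (simp add: mk_symmetric_def)
    qed
    then show ?thesis
      using that by (auto simp: connected_def strongly_connected_def reachable_def mk_symmetric_def)
  qed
  have verts: "pverts (complete_graph n) = {..<n}"
    by (simp add: complete_graph_def)
  show ?thesis
    unfolding vertex_connectivity_def verts
  proof (rule Least_equality)
    have "{..<n} - {..<n - 1} = {n - 1}" using assms by auto
    then show "\<exists>S\<subseteq>{..<n}. card S = n - 1 \<and>
      (\<not> connected (with_proj (complete_graph n) \<restriction> ({..<n} - S)) \<or> card ({..<n} - S) = 1)"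
      by (intro exI[of _ "{..<n - 1}"]) auto
  next
    fix m
    assume "\<exists>S\<subseteq>{..<n}. card S = m \<and>
      (\<not> connected (with_proj (complete_graph n) \<restriction> ({..<n} - S)) \<or> card ({..<n} - S) = 1)"
    then obtain S where S: "S \<subseteq> {..<n}" "card S = m"
      and "{..<n} - S = {} \<or> card ({..<n} - S) = 1"
      using conn[of "{..<n} - S" for S] by blast
    then have "card ({..<n} - S) \<le> 1" by auto
    moreover have "card ({..<n} - S) = n - m"
      using S by (simp add: card_Diff_subset finite_subset)
    ultimately show "n - 1 \<le> m" by simp
  qed
qed

end

theory Submission
  imports Defs
begin

text \<open>
  Saturate a nontraceable graph \<open>G\<close> by adding edges as long as it stays nontraceable. By an Ore-type
  exchange, non-adjacent vertices of the saturated graph have degree sum at most \<open>n - 2\<close>, and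
  Chvatal's choice of a non-adjacent pair yields an \<open>m\<close> with \<open>k \<le> m \<le> (n - 2) / 2\<close> and a set
  \<open>X\<close> of \<open>m + 1\<close> vertices of degree at most \<open>m\<close>. This alone bounds the size by
  \<open>(n - m - 1 choose 2) + m (m + 1)\<close>. A separating set of \<open>k\<close> vertices costs another \<open>m - k\<close>
  edges: if both sides of the separation leave \<open>X\<close>, they lose edges outside \<open>X\<close>, and otherwise a
  side contained in \<open>X\<close> has too few neighbours. In the case of equality the saturation
  inequalities force the neighbourhoods of the vertices in \<open>X\<close> to be nested, which determines
  \<open>G\<close>. The resulting bound is strictly convex in \<open>m\<close>, so only \<open>m = k\<close> and
  \<open>m = \<lfloor>(n - 2) / 2\<rfloor>\<close> matter.
\<close>

section \<open>Hamilton paths and saturation\<close>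

text \<open>Saturation can raise the connectivity, so the cut of \<open>k\<close> vertices is
  visible only in the given graph \<open>E\<close>, while the degree-sum condition holds only in its
  saturation \<open>E'\<close>. Both relations are therefore carried along on one vertex set. Bounds
  on degrees pass from \<open>E'\<close> down to \<open>E\<close>. At equality adjacencies pass down
  as well: a vertex of \<open>X\<close> that has \<open>m\<close> neighbours in \<open>E\<close>
  gains none in \<open>E'\<close>, so an arc at it that is forced in \<open>E'\<close> is already in
  \<open>E\<close>.

  Arcs are counted instead of edges, which avoids halves. The loss \<open>m - k\<close> is the price
  of a single vertex of \<open>X\<close> with only \<open>k\<close> neighbours.

  The three extremal graphs belong to one family: \<open>m = k\<close> gives the join with a large
  clique, while for the largest \<open>m\<close> only two vertices (\<open>H1\<close>) or one vertex
  (\<open>H2\<close>) remain outside \<open>X\<close> and the joined clique. A single remaining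
  vertex looks like a member of \<open>X\<close>. So for \<open>card V = 2 * m + 2\<close> the set
  \<open>X\<close> is not unique, and the one obtained from saturation may miss the vertex of degree
  \<open>k\<close>; this is the source of the delicate equality cases.\<close>

definition simple_graph :: "'a set \<Rightarrow> 'a rel \<Rightarrow> bool" where
  "simple_graph V E \<longleftrightarrow> finite V \<and> E \<subseteq> V \<times> V \<and> sym E \<and> irrefl E"

definition deg :: "'a rel \<Rightarrow> 'a \<Rightarrow> nat" where
  "deg E v = card (E `` {v})"

definition ham_path :: "'a set \<Rightarrow> 'a rel \<Rightarrow> 'a list \<Rightarrow> bool" where
  "ham_path V E xs \<longleftrightarrow> distinct xs \<and> set xs = V \<and> successively (\<lambda>u v. (u, v) \<in> E) xs"

lemma simple_graphD:
  assumes "simple_graph V E"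
  shows "finite V" "finite E" "(u, v) \<in> E \<Longrightarrow> (v, u) \<in> E" "(u, u) \<notin> E"
    "(u, v) \<in> E \<Longrightarrow> u \<in> V" "(u, v) \<in> E \<Longrightarrow> v \<in> V" "finite (E `` A)" "E `` A \<subseteq> V"
  using assms finite_subset[of E "V \<times> V"] finite_subset[of "E `` A" V]
  by (auto simp: simple_graph_def dest: symD irreflD)

lemma deg_mono: "simple_graph V E' \<Longrightarrow> E \<subseteq> E' \<Longrightarrow> deg E v \<le> deg E' v"
  unfolding deg_def by (rule card_mono) (auto simp: simple_graphD(7))

lemma pair_graph_iff_simple_graph: "pair_graph G \<longleftrightarrow> simple_graph (pverts G) (parcs G)"
proof
  assume "pair_graph G"
  then interpret pair_graph G .
  show "simple_graph (pverts G) (parcs G)"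
    using pair_finite_verts pair_no_loops[of "(a, a)" for a] pair_sym_arcs
    by (auto simp: simple_graph_def irrefl_def symmetric_def dest: in_arcsD1 in_arcsD2)
next
  assume *: "simple_graph (pverts G) (parcs G)"
  show "pair_graph G"
    using * simple_graphD(2)[OF *]
    by unfold_locales (auto simp: simple_graph_def symmetric_def irrefl_def)
qed

lemma set_vwalk_arcs_subset_iff: "set (vwalk_arcs p) \<subseteq> E \<longleftrightarrow> successively (\<lambda>u v. (u, v) \<in> E) p"
  by (induction p rule: vwalk_arcs.induct) auto

text \<open>The two notions part ways on the empty graph: the empty list is a
  \<open>ham_path\<close> there, but a \<open>vpath\<close> is never empty.\<close>

lemma traceable_iff_ham_path:
  assumes "pverts G \<noteq> {}"
  shows "traceable G \<longleftrightarrow> (\<exists>xs. ham_path (pverts G) (parcs G) xs)"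
  using assms
  by (auto simp: traceable_def vpath_def vwalk_def ham_path_def set_vwalk_arcs_subset_iff)

lemma successively_sym_rev:
  assumes "sym E" "successively (\<lambda>u v. (u, v) \<in> E) xs"
  shows "successively (\<lambda>u v. (u, v) \<in> E) (rev xs)"
  using assms(2) symD[OF assms(1)] by (auto simp: successively_rev intro: successively_mono)

text \<open>In a distinct list \<open>u\<close> and \<open>v\<close> occur at most once, so at most
  one step uses the new edge. Cutting there leaves two lists that walk along old arcs only.\<close>

lemma successively_insert_arcs:
  assumes "successively (\<lambda>x y. (x, y) \<in> insert (u, v) (insert (v, u) E)) xs" "distinct xs"
    "\<not> successively (\<lambda>x y. (x, y) \<in> E) xs"
  obtains ys zs where "xs = ys @ zs" "ys \<noteq> []" "zs \<noteq> []"
    "{last ys, hd zs} = {u, v}"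
    "successively (\<lambda>x y. (x, y) \<in> E) ys" "successively (\<lambda>x y. (x, y) \<in> E) zs"
proof -
  have "\<exists>ys zs. xs = ys @ zs \<and> ys \<noteq> [] \<and> zs \<noteq> [] \<and> {last ys, hd zs} = {u, v} \<and>
    successively (\<lambda>x y. (x, y) \<in> E) ys \<and> successively (\<lambda>x y. (x, y) \<in> E) zs"
    using assms
  proof (induction xs)
    case Nil
    then show ?case by simp
  next
    case (Cons x xs)
    have ne: "xs \<noteq> []" using Cons.prems by auto
    have rest: "successively (\<lambda>x y. (x, y) \<in> insert (u, v) (insert (v, u) E)) xs" "distinct xs"
      using Cons.prems ne by (auto simp: successively_Cons)
    show ?case
    proof (cases "successively (\<lambda>x y. (x, y) \<in> E) xs")
      case True
      then have "(x, hd xs) \<notin> E" using Cons.prems ne by (auto simp: successively_Cons)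
      moreover have "(x, hd xs) \<in> insert (u, v) (insert (v, u) E)"
        using Cons.prems(1) ne by (cases xs) simp_all
      ultimately have "{x, hd xs} = {u, v}" by auto
      then show ?thesis using True ne by (intro exI[of _ "[x]"] exI[of _ xs]) simp
    next
      case False
      obtain ys zs where *: "xs = ys @ zs" "ys \<noteq> []" "zs \<noteq> []" "{last ys, hd zs} = {u, v}"
        "successively (\<lambda>x y. (x, y) \<in> E) ys" "successively (\<lambda>x y. (x, y) \<in> E) zs"
        using Cons.IH[OF rest False] by blast
      have "last ys \<in> set xs" "hd zs \<in> set xs" using *(1-3) by auto
      then have "{u, v} \<subseteq> set xs" unfolding *(4)[symmetric] by blast
      then have "x \<notin> {u, v}" using Cons.prems(2) by auto
      moreover have "(x, hd xs) \<in> insert (u, v) (insert (v, u) E)"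
        using Cons.prems(1) ne by (cases xs) simp_all
      ultimately have "(x, hd xs) \<in> E" by auto
      moreover have "hd xs = hd ys" using *(1,2) by simp
      ultimately have "successively (\<lambda>x y. (x, y) \<in> E) (x # ys)"
        using *(2,5) by (simp add: successively_Cons)
      moreover have "x # xs = (x # ys) @ zs" "{last (x # ys), hd zs} = {u, v}"
        using *(1,2,4) by simp_all
      ultimately show ?thesis using *(3,6) by blast
    qed
  qed
  then show thesis using that by blast
qed

text \<open>
  Ore's exchange argument: deleting the arc leaves two paths \<open>q\<close> (ending in \<open>u\<close>) and \<open>p\<close>
  (starting in \<open>v\<close>); along the sequence \<open>p @ q\<close> no vertex adjacent to \<open>u\<close> is directly
  followed by one adjacent to \<open>v\<close>, and at the junction neither adjacency occurs.
\<close>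

lemma ham_path_reconnect:
  assumes "sym E" and dist: "distinct (q @ p)"
    and ne: "q \<noteq> []" "p \<noteq> []" and u: "last q = u" and v: "hd p = v"
    and sq: "successively (\<lambda>x y. (x, y) \<in> E) q" and sp: "successively (\<lambda>x y. (x, y) \<in> E) p"
    and "simple_graph V E" and V: "set (q @ p) = V"
    and none: "\<nexists>xs. ham_path V E xs"
  shows "deg E u + deg E v + 2 \<le> card V"
proof -
  let ?s = "successively (\<lambda>x y. (x, y) \<in> E)"
  note sg = simple_graphD[OF \<open>simple_graph V E\<close>]
  define W where "W = p @ q"
  define n where "n = length W"
  define l where "l = length p"
  have n: "n = card V" using dist V distinct_card[of "q @ p"] by (simp add: n_def W_def)
  have setW: "set W = V" and dW: "distinct W" using V dist by (auto simp: W_def)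
  have lpos: "0 < l" "l < n" using ne by (auto simp: l_def n_def W_def)
  have W0: "W ! 0 = v" using ne v by (simp add: W_def nth_append hd_conv_nth)
  have "last W = u" using ne u by (simp add: W_def)
  then have Wl: "W ! (n - 1) = u" using ne by (simp add: W_def n_def last_conv_nth)
  have rs: "?s (rev xs)" if "?s xs" for xs using successively_sym_rev[OF assms(1) that] .
  have symE: "(a, b) \<in> E \<Longrightarrow> (b, a) \<in> E" for a b by (rule sg(3))
  have no: False if "?s xs" "set xs = V" "length xs = n" for xs
    using that none n card_distinct[of xs] by (auto simp: ham_path_def)
  \<comment> \<open>An arc from \<open>u\<close> to the end of \<open>p\<close> would give the
    Hamilton path \<open>q @ rev p\<close>, one from \<open>v\<close> to the start of
    \<open>q\<close> the path \<open>rev q @ p\<close>.\<close>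
  have cross: "(u, W ! (l - 1)) \<notin> E" "(v, W ! l) \<notin> E"
  proof
    assume *: "(u, W ! (l - 1)) \<in> E"
    have "W ! (l - 1) = last p" using ne by (simp add: W_def l_def nth_append last_conv_nth)
    then have "?s (q @ rev p)" using * sq rs[OF sp] u ne
      by (simp add: successively_append_iff hd_rev del: successively_rev)
    then show False using V by (intro no[of "q @ rev p"]) (auto simp: n_def W_def)
  next
    show "(v, W ! l) \<notin> E"
    proof
      assume *: "(v, W ! l) \<in> E"
      have "W ! l = hd q" using ne by (simp add: W_def l_def nth_append hd_conv_nth)
      then have "?s (rev q @ p)" using rs[OF sq] sp v ne symE[OF *]
        by (simp add: successively_append_iff last_rev del: successively_rev)
      then show False using V by (intro no[of "rev q @ p"]) (auto simp: n_def W_def)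
    qed
  qed
  \<comment> \<open>As \<open>j\<close> is not the junction, positions \<open>j\<close> and
    \<open>Suc j\<close> lie both in \<open>p\<close> or both in \<open>q\<close>. Reversing the
    part of \<open>p\<close> up to \<open>j\<close>, or the part of \<open>q\<close> after
    \<open>j\<close>, makes the two arcs the links of a Hamilton path.\<close>
  have step: "\<not> ((u, W ! j) \<in> E \<and> (v, W ! (Suc j)) \<in> E)" if j: "j < n - 1" "j \<noteq> l - 1" for j
  proof
    assume *: "(u, W ! j) \<in> E \<and> (v, W ! (Suc j)) \<in> E"
    show False
    proof (cases "Suc j < l")
      case True
      define a b where "a = take (Suc j) p" and "b = drop (Suc j) p"
      have p: "p = a @ b" by (simp add: a_def b_def)
      have ab: "a \<noteq> []" "b \<noteq> []" using True ne by (auto simp: a_def b_def l_def)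
      have last: "last a = W ! j" using True
        by (simp add: a_def W_def l_def nth_append last_conv_nth ne)
      have hd: "hd b = W ! Suc j" using True
        by (simp add: b_def W_def l_def nth_append hd_drop_conv_nth)
      have hda: "hd a = v" using v ab by (simp add: p)
      have "?s a" "?s b" using sp by (simp_all add: p successively_append_iff)
      then have "?s (q @ rev a @ b)"
        using sq ab rs[of a] ne * u last hd hda
        by (simp add: successively_append_iff hd_rev last_rev del: successively_rev)
      then show False using V p by (intro no[of "q @ rev a @ b"]) (auto simp: n_def W_def)
    next
      case False
      then have jl: "j \<ge> l" using j lpos by linarith
      define i where "i = j - l"
      have i: "Suc i < length q" using j jl by (auto simp: i_def n_def W_def l_def)
      have Wj: "W ! j = q ! i" "W ! Suc j = q ! Suc i" using jl
        by (auto simp: W_def i_def l_def nth_append Suc_diff_le)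
      define a b where "a = take (Suc i) q" and "b = drop (Suc i) q"
      have q: "q = a @ b" by (simp add: a_def b_def)
      have ab: "a \<noteq> []" "b \<noteq> []" using i by (auto simp: a_def b_def)
      have last: "last a = W ! j" using i Wj
        by (simp add: a_def last_conv_nth ne)
      have hd: "hd b = W ! Suc j" using i Wj
        by (simp add: b_def hd_drop_conv_nth)
      have lb: "last b = u" using u ab by (simp add: q)
      have "?s a" "?s b" using sq by (simp_all add: q successively_append_iff)
      then have "?s (a @ rev b @ p)"
        using sp ab rs[of b] ne symE[OF conjunct1[OF *]] symE[OF conjunct2[OF *]] v last hd lb
        by (simp add: successively_append_iff hd_rev last_rev del: successively_rev)
      then show False using V q by (intro no[of "a @ rev b @ p"]) (auto simp: n_def W_def)
    qed
  qed
  \<comment> \<open>\<open>W\<close> ends in \<open>u\<close> and starts with \<open>v\<close>, and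
    neither is its own neighbour; so nothing is lost by leaving out the last position for
    \<open>u\<close> and the first for \<open>v\<close>. The shift by one makes \<open>I\<close> and
    \<open>J\<close> disjoint subsets of \<open>{..<n - 1}\<close>, and both miss
    \<open>l - 1\<close>: hence the bound \<open>n - 2\<close>.\<close>
  define I where "I = {j. j < n - 1 \<and> (u, W ! j) \<in> E}"
  define J where "J = {j. j < n - 1 \<and> (v, W ! Suc j) \<in> E}"
  have inj: "inj_on ((!) W) {..<n}" using dW by (auto simp: inj_on_def n_def nth_eq_iff_index_eq)
  have "E `` {u} = (!) W ` I"
  proof (rule equalityI; rule subsetI)
    fix x assume x: "x \<in> E `` {u}"
    then have "x \<in> set W" using sg(6) setW by auto
    then obtain j where j: "j < n" "x = W ! j" by (auto simp: in_set_conv_nth n_def)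
    have "j \<noteq> n - 1"
    proof
      assume "j = n - 1"
      then have "(u, u) \<in> E" using x j Wl by simp
      then show False using sg(4) by blast
    qed
    then show "x \<in> (!) W ` I" using x j by (auto simp: I_def)
  qed (auto simp: I_def)
  moreover have "inj_on ((!) W) I" by (rule inj_on_subset[OF inj]) (auto simp: I_def)
  ultimately have du: "deg E u = card I"
    unfolding deg_def by (simp add: card_image)
  have "E `` {v} = (\<lambda>j. W ! Suc j) ` J"
  proof (rule equalityI; rule subsetI)
    fix x assume x: "x \<in> E `` {v}"
    then have "x \<in> set W" using sg(6) setW by auto
    then obtain j where j: "j < n" "x = W ! j" by (auto simp: in_set_conv_nth n_def)
    have "j \<noteq> 0"
    proof
      assume "j = 0"
      then have "(v, v) \<in> E" using x j W0 by simp
      then show False using sg(4) by blast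
    qed
    then obtain i where "j = Suc i" by (cases j) auto
    then show "x \<in> (\<lambda>j. W ! Suc j) ` J" using x j by (auto simp: J_def)
  qed (auto simp: J_def)
  moreover have "inj_on (\<lambda>j. W ! Suc j) J"
  proof (rule inj_onI)
    fix i j assume "i \<in> J" "j \<in> J" and eq: "W ! Suc i = W ! Suc j"
    then have "Suc i \<in> {..<n}" "Suc j \<in> {..<n}" by (auto simp: J_def)
    then show "i = j" using inj_onD[OF inj eq] by simp
  qed
  ultimately have dv: "deg E v = card J"
    unfolding deg_def by (simp add: card_image)
  have disj: "I \<inter> J = {}"
  proof (rule equals0I)
    fix j assume "j \<in> I \<inter> J"
    then have "j < n - 1" "(u, W ! j) \<in> E" "(v, W ! Suc j) \<in> E" by (auto simp: I_def J_def)
    then show False using step[of j] cross(1) by blast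
  qed
  have "l - 1 \<notin> I" "l - 1 \<notin> J" using cross lpos by (simp_all add: I_def J_def)
  then have "I \<union> J \<subseteq> {..<n - 1} - {l - 1}" by (auto simp: I_def J_def)
  then have "card (I \<union> J) \<le> card ({..<n - 1} - {l - 1})" by (intro card_mono) auto
  also have "\<dots> = n - 2" using lpos by (simp add: card_Diff_singleton_if numeral_2_eq_2)
  finally have "card I + card J \<le> n - 2"
    using disj by (subst (asm) card_Un_disjoint) (auto simp: I_def J_def)
  then show ?thesis using du dv n lpos by linarith
qed

lemma ham_path_delete_edge:
  assumes sg: "simple_graph V E" and "ham_path V (insert (u, v) (insert (v, u) E)) xs"
    and none: "\<nexists>xs. ham_path V E xs"
  shows "deg E u + deg E v + 2 \<le> card V"
proof -
  have symE: "sym E" using sg by (simp add: simple_graph_def)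
  obtain ys zs where *: "xs = ys @ zs" "ys \<noteq> []" "zs \<noteq> []" "{last ys, hd zs} = {u, v}"
    "successively (\<lambda>x y. (x, y) \<in> E) ys" "successively (\<lambda>x y. (x, y) \<in> E) zs"
    using assms(2) none successively_insert_arcs[of u v E xs] unfolding ham_path_def by blast
  have "distinct (ys @ zs)" "set (ys @ zs) = V" using assms(2) *(1) by (auto simp: ham_path_def)
  then have "deg E (last ys) + deg E (hd zs) + 2 \<le> card V"
    using ham_path_reconnect[OF symE _ *(2,3) refl refl *(5,6) sg _ none] by blast
  moreover have "last ys = u \<and> hd zs = v \<or> last ys = v \<and> hd zs = u"
    using *(4) by (auto simp: doubleton_eq_iff)
  ultimately show ?thesis by (auto simp: add.commute)
qed

lemma complete_ham_path:
  assumes "finite V" "\<And>u v. u \<in> V \<Longrightarrow> v \<in> V \<Longrightarrow> u \<noteq> v \<Longrightarrow> (u, v) \<in> E"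
  shows "\<exists>xs. ham_path V E xs"
proof -
  obtain xs where xs: "set xs = V" "distinct xs"
    using finite_distinct_list[OF assms(1)] by blast
  have "successively (\<lambda>u v. (u, v) \<in> E) xs"
    unfolding successively_conv_nth
  proof (intro allI impI)
    fix i assume "Suc i < length xs"
    then show "(xs ! i, xs ! Suc i) \<in> E"
      using xs by (intro assms(2)) (auto simp: nth_eq_iff_index_eq)
  qed
  then show ?thesis using xs by (auto simp: ham_path_def)
qed

lemma nontraceable_saturation:
  assumes "simple_graph V E" "\<nexists>xs. ham_path V E xs"
  obtains E' where "simple_graph V E'" "E \<subseteq> E'" "\<nexists>xs. ham_path V E' xs"
    "\<And>u v. u \<in> V \<Longrightarrow> v \<in> V \<Longrightarrow> u \<noteq> v \<Longrightarrow> (u, v) \<notin> E' \<Longrightarrow> deg E' u + deg E' v + 2 \<le> card V"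
proof -
  define \<A> where "\<A> = {E'. simple_graph V E' \<and> E \<subseteq> E' \<and> (\<nexists>xs. ham_path V E' xs)}"
  have "\<A> \<subseteq> Pow (V \<times> V)" by (auto simp: \<A>_def simple_graph_def)
  moreover have "finite V" using assms(1) by (simp add: simple_graph_def)
  ultimately have "finite \<A>" by (meson finite_Pow_iff finite_SigmaI finite_subset)
  moreover have "E \<in> \<A>" using assms by (simp add: \<A>_def)
  ultimately obtain E' where E': "E' \<in> \<A>" and max: "\<And>F. F \<in> \<A> \<Longrightarrow> E' \<subseteq> F \<Longrightarrow> E' = F"
    using finite_has_maximal[of \<A>] by blast
  have sg: "simple_graph V E'" and sub: "E \<subseteq> E'" and none: "\<nexists>xs. ham_path V E' xs"
    using E' unfolding \<A>_def by blast+
  show thesis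
  proof (rule that[OF sg sub none])
    fix u v assume uv: "u \<in> V" "v \<in> V" "u \<noteq> v" "(u, v) \<notin> E'"
    let ?F = "insert (u, v) (insert (v, u) E')"
    have "simple_graph V ?F" using sg uv by (auto simp: simple_graph_def sym_def irrefl_def)
    then have "\<exists>xs. ham_path V ?F xs" using max[of ?F] uv(4) sub unfolding \<A>_def by blast
    then show "deg E' u + deg E' v + 2 \<le> card V" using ham_path_delete_edge[OF sg _ none] by blast
  qed
qed

text \<open>
  Chvatal's argument: among the non-adjacent pairs of a saturated graph choose \<open>u\<close>, \<open>v\<close> with
  maximal degree sum and \<open>deg u \<le> deg v\<close>; every non-neighbour of \<open>v\<close> has degree at most \<open>deg u\<close>.
\<close>

lemma saturated_low_degree_set:
  assumes sg: "simple_graph V E" and none: "\<nexists>xs. ham_path V E xs"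
    and sum: "\<And>u v. u \<in> V \<Longrightarrow> v \<in> V \<Longrightarrow> u \<noteq> v \<Longrightarrow> (u, v) \<notin> E \<Longrightarrow> deg E u + deg E v + 2 \<le> card V"
  shows "\<exists>u\<in>V. \<exists>X\<subseteq>V. card X = deg E u + 1 \<and> (\<forall>x\<in>X. deg E x \<le> deg E u) \<and> 2 * deg E u + 2 \<le> card V"
proof -
  note sgD = simple_graphD[OF sg]
  define P where "P = {(u, v). u \<in> V \<and> v \<in> V \<and> u \<noteq> v \<and> (u, v) \<notin> E}"
  let ?f = "\<lambda>(u, v). deg E u + deg E v"
  have finP: "finite P" using finite_subset[of P "V \<times> V"] sgD(1) by (auto simp: P_def)
  have "P \<noteq> {}" using complete_ham_path[OF sgD(1), of E] none unfolding P_def by blast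
  then have "Max (?f ` P) \<in> ?f ` P" using finP by (intro Max_in) auto
  then obtain p where p: "p \<in> P" "Max (?f ` P) = ?f p" by (rule imageE)
  have pmax: "?f q \<le> ?f p" if "q \<in> P" for q unfolding p(2)[symmetric] using that finP by (intro Max_ge) auto
  have Psym: "(b, a) \<in> P" if "(a, b) \<in> P" for a b using that sgD(3)[of b a] by (auto simp: P_def)
  obtain a b where ab: "p = (a, b)" by (cases p)
  define u where "u = (if deg E a \<le> deg E b then a else b)"
  define v where "v = (if deg E a \<le> deg E b then b else a)"
  have uv: "(u, v) \<in> P" using p(1) ab Psym[of a b] by (simp add: u_def v_def)
  have le: "deg E u \<le> deg E v" by (simp add: u_def v_def)
  have max: "deg E c + deg E d \<le> deg E u + deg E v" if "(c, d) \<in> P" for c d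
    using pmax[OF that] ab by (simp add: u_def v_def split: if_splits)
  have uvV: "u \<in> V" "v \<in> V" "u \<noteq> v" "(u, v) \<notin> E" using uv by (auto simp: P_def)
  \<comment> \<open>There are \<open>card V - 1 - deg E v\<close> such non-neighbours, and the
    degree-sum condition for \<open>u\<close> and \<open>v\<close> makes this at least
    \<open>deg E u + 1\<close>.\<close>
  let ?Y = "V - insert v (E `` {v})"
  have "card ?Y = card V - (deg E v + 1)"
    using sgD(4)[of v] sgD(7,8)[of "{v}"] uvV(2) by (subst card_Diff_subset) (simp_all add: deg_def)
  then have "deg E u + 1 \<le> card ?Y" using sum[OF uvV] by linarith
  then obtain X where X: "X \<subseteq> ?Y" "card X = deg E u + 1" by (meson obtain_subset_with_card_n)
  have "deg E x \<le> deg E u" if "x \<in> X" for x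
  proof -
    have "(x, v) \<in> P" using that X(1) uvV(2) sgD(3)[of x v] by (auto simp: P_def)
    then show ?thesis using max[of x v] by simp
  qed
  moreover have "2 * deg E u + 2 \<le> card V" using sum[OF uvV] le by linarith
  ultimately show ?thesis using X uvV by blast
qed

section \<open>The size bound\<close>

text \<open>The choice \<open>N = T\<close> makes \<open>w\<close> an ordinary vertex of
  \<open>X\<close>; this describes the graphs before any edge is deleted.\<close>

definition split_arcs :: "'a set \<Rightarrow> 'a set \<Rightarrow> 'a set \<Rightarrow> 'a set \<Rightarrow> 'a \<Rightarrow> 'a rel" where
  "split_arcs V X T N w = {(u, v). u \<in> V \<and> v \<in> V \<and> u \<noteq> v \<and>
     (u \<in> X \<longrightarrow> v \<in> T \<and> (u = w \<longrightarrow> v \<in> N)) \<and> (v \<in> X \<longrightarrow> u \<in> T \<and> (v = w \<longrightarrow> u \<in> N))}"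

text \<open>
  The common shape of all extremal graphs: the join of a clique \<open>T\<close> with the disjoint union of a
  clique on \<open>V - T - X\<close> and the independent set \<open>X\<close>, where one vertex \<open>w\<close> of \<open>X\<close> keeps only its
  \<open>k\<close> edges to \<open>N\<close>.
\<close>

definition split_like :: "nat \<Rightarrow> nat \<Rightarrow> 'a set \<Rightarrow> 'a rel \<Rightarrow> bool" where
  "split_like m k V E \<longleftrightarrow> (\<exists>X T N w. X \<subseteq> V \<and> T \<subseteq> V \<and> X \<inter> T = {} \<and> N \<subseteq> T \<and> w \<in> X \<and>
     card X = m + 1 \<and> card T = m \<and> card N = k \<and> E = split_arcs V X T N w)"

lemma card_offdiagonal:
  assumes "finite A"
  shows "card {(u, v). u \<in> A \<and> v \<in> A \<and> u \<noteq> v} = card A * (card A - 1)"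
proof -
  have "{(u, v). u \<in> A \<and> v \<in> A \<and> u \<noteq> v} = Sigma A (\<lambda>u. A - {u})" by auto
  then show ?thesis using assms by simp
qed

lemma sum_deg_Int:
  assumes "simple_graph V E" "finite A"
  shows "(\<Sum>x\<in>A. card (E `` {x} \<inter> B)) = card (E \<inter> A \<times> B)"
proof -
  have "E \<inter> A \<times> B = Sigma A (\<lambda>x. E `` {x} \<inter> B)" by auto
  then show ?thesis using assms simple_graphD(7)[OF assms(1)] by simp
qed

text \<open>The degree sum counts the arcs that start in \<open>X\<close>. Reversal matches those
  among them that leave \<open>X\<close> with the arcs entering \<open>X\<close>, so doubling the
  sum counts the arcs inside \<open>X\<close> once too often.\<close>

lemma card_arcs_split:
  assumes sg: "simple_graph V E" and X: "X \<subseteq> V"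
  shows "card E + card (E \<inter> X \<times> X) = card (E \<inter> (V - X) \<times> (V - X)) + 2 * (\<Sum>x\<in>X. deg E x)"
proof -
  note sgD = simple_graphD[OF sg]
  have finX: "finite X" using sgD(1) X finite_subset by blast
  have fin: "finite (E \<inter> A)" for A using sgD(2) by blast
  have "(\<Sum>x\<in>X. deg E x) = (\<Sum>x\<in>X. card (E `` {x} \<inter> V))"
    using sgD(8) by (simp add: deg_def Int_absorb2)
  also have "\<dots> = card (E \<inter> X \<times> V)" by (rule sum_deg_Int[OF sg finX])
  also have "E \<inter> X \<times> V = E \<inter> X \<times> X \<union> E \<inter> X \<times> (V - X)" using X by auto
  also have "card \<dots> = card (E \<inter> X \<times> X) + card (E \<inter> X \<times> (V - X))"
    by (rule card_Un_disjoint) (use fin in auto)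
  finally have 1: "(\<Sum>x\<in>X. deg E x) = card (E \<inter> X \<times> X) + card (E \<inter> X \<times> (V - X))" .
  have "E \<inter> (V - X) \<times> X = prod.swap ` (E \<inter> X \<times> (V - X))"
    using sgD(3) by (force simp: image_iff)
  then have 2: "card (E \<inter> (V - X) \<times> X) = card (E \<inter> X \<times> (V - X))"
    by (simp add: card_image)
  have "E = (E \<inter> X \<times> V) \<union> (E \<inter> (V - X) \<times> X \<union> E \<inter> (V - X) \<times> (V - X))"
    (is "_ = ?A \<union> ?B")
    using sg by (auto simp: simple_graph_def)
  moreover have "card (?A \<union> ?B) = card ?A + card ?B"
    by (rule card_Un_disjoint) (use fin in auto)
  ultimately have "card E = card ?A + card ?B" by simp
  also have "card (E \<inter> (V - X) \<times> X \<union> E \<inter> (V - X) \<times> (V - X)) =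
      card (E \<inter> (V - X) \<times> X) + card (E \<inter> (V - X) \<times> (V - X))"
    by (rule card_Un_disjoint) (use fin in auto)
  also have "card (E \<inter> X \<times> V) = (\<Sum>x\<in>X. deg E x)"
    using \<open>(\<Sum>x\<in>X. card (E `` {x} \<inter> V)) = card (E \<inter> X \<times> V)\<close>
      \<open>(\<Sum>x\<in>X. deg E x) = (\<Sum>x\<in>X. card (E `` {x} \<inter> V))\<close> by simp
  finally show ?thesis using 1 2 by simp
qed

lemma sum_eq_bound_imp_eq:
  fixes f :: "'a \<Rightarrow> nat"
  assumes "finite A" "\<And>x. x \<in> A \<Longrightarrow> f x \<le> m" "(\<Sum>x\<in>A. f x) \<ge> card A * m" "x \<in> A"
  shows "f x = m"
proof (rule ccontr)
  assume "f x \<noteq> m"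
  then have "f x < m" using assms(2)[OF assms(4)] by simp
  then have "(\<Sum>x\<in>A. f x) < (\<Sum>x\<in>A. m)"
    using assms by (intro sum_strict_mono_ex1) auto
  then show False using assms(3) by simp
qed

text \<open>Nontraceability survives only in the degree-sum condition \<open>sat\<close>; within
  this locale the argument is one of counting degrees.\<close>

locale saturated_supergraph =
  fixes V :: "'a set" and E E' :: "'a rel" and X :: "'a set" and m :: nat
  assumes sg: "simple_graph V E" and sg': "simple_graph V E'" and sub: "E \<subseteq> E'"
    and sat: "\<And>u v. u \<in> V \<Longrightarrow> v \<in> V \<Longrightarrow> u \<noteq> v \<Longrightarrow> (u, v) \<notin> E' \<Longrightarrow> deg E' u + deg E' v + 2 \<le> card V"
    and XV: "X \<subseteq> V" and cardX: "card X = m + 1"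
    and deg'X: "\<And>x. x \<in> X \<Longrightarrow> deg E' x \<le> m"
    and order: "2 * m + 2 \<le> card V"
begin

lemma finV: "finite V" using sg by (simp add: simple_graph_def)
lemma finX: "finite X" using finV XV finite_subset by blast
lemma finE: "finite (E `` A)" by (rule simple_graphD(7)[OF sg])
lemma finE': "finite (E' `` A)" by (rule simple_graphD(7)[OF sg'])
lemma E_sym: "(u, v) \<in> E \<Longrightarrow> (v, u) \<in> E" by (rule simple_graphD(3)[OF sg])
lemma E'_sym: "(u, v) \<in> E' \<Longrightarrow> (v, u) \<in> E'" by (rule simple_graphD(3)[OF sg'])
lemma E_irrefl: "(u, u) \<notin> E" by (rule simple_graphD(4)[OF sg])
lemma E_V: "(u, v) \<in> E \<Longrightarrow> u \<in> V \<and> v \<in> V"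
  using sg by (auto simp: simple_graph_def)

lemma deg_le': "deg E v \<le> deg E' v"
  by (rule deg_mono[OF sg' sub])

lemma degX: "x \<in> X \<Longrightarrow> deg E x \<le> m"
  using deg_le' deg'X le_trans by blast

lemma sum_degX: "A \<subseteq> X \<Longrightarrow> (\<Sum>x\<in>A. deg E x) \<le> card A * m"
  using sum_bounded_above[of A "deg E" m] degX by auto

lemma cardVX: "card (V - X) = card V - m - 1"
  using XV finX cardX by (simp add: card_Diff_subset)

abbreviation inner :: "'a rel" where "inner \<equiv> E \<inter> (V - X) \<times> (V - X)"

definition clique_outside :: bool where
  "clique_outside \<longleftrightarrow> (\<forall>u\<in>V - X. \<forall>v\<in>V - X. u \<noteq> v \<longrightarrow> (u, v) \<in> E)"

definition indep :: bool where
  "indep \<longleftrightarrow> E \<inter> X \<times> X = {}"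

lemma inner_subset: "inner \<subseteq> {(u, v). u \<in> V - X \<and> v \<in> V - X \<and> u \<noteq> v}"
  using E_irrefl by auto

lemma card_inner_le: "card inner \<le> card (V - X) * (card (V - X) - 1)"
proof -
  have fin: "finite {(u, v). u \<in> V - X \<and> v \<in> V - X \<and> u \<noteq> v}"
    using finV by (auto intro: finite_subset[of _ "V \<times> V"])
  show ?thesis using card_mono[OF fin inner_subset] card_offdiagonal[of "V - X"] finV by simp
qed

lemma clique_outsideI:
  assumes "card inner \<ge> card (V - X) * (card (V - X) - 1)"
  shows clique_outside
proof -
  let ?D = "{(u, v). u \<in> V - X \<and> v \<in> V - X \<and> u \<noteq> v}"
  have "finite ?D" using finV by (auto intro: finite_subset[of _ "V \<times> V"])
  moreover have "card inner = card ?D"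
    using assms card_inner_le card_offdiagonal[of "V - X"] finV by simp
  ultimately have "inner = ?D" using inner_subset by (intro card_subset_eq)
  then show ?thesis unfolding clique_outside_def by blast
qed

lemma indepI: "card (E \<inter> X \<times> X) = 0 \<Longrightarrow> indep"
  using simple_graphD(2)[OF sg] by (simp add: indep_def)

lemma card_E: "card E + card (E \<inter> X \<times> X) = card inner + 2 * (\<Sum>x\<in>X. deg E x)"
  by (rule card_arcs_split[OF sg XV])

text \<open>The vertex \<open>t\<close> sees the rest of \<open>V - X\<close> and also
  \<open>y\<close>, so its degree is at least \<open>card V - m - 1\<close>. With the degree
  \<open>m\<close> of \<open>x\<close> this exceeds what \<open>sat\<close> allows to a non-adjacent
  pair, so \<open>t\<close> and \<open>x\<close> are adjacent in \<open>E'\<close>. Since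
  \<open>x\<close> has at most \<open>m\<close> neighbours in \<open>E'\<close>, they are the ones
  it has in \<open>E\<close>.\<close>

lemma adjacent_low_degree:
  assumes clique_outside "x \<in> X" "deg E x = m" "t \<in> V - X" "y \<in> X" "(t, y) \<in> E"
  shows "(t, x) \<in> E"
proof -
  have "insert y (V - X - {t}) \<subseteq> E `` {t}"
  proof
    fix s assume "s \<in> insert y (V - X - {t})"
    then consider "s = y" | "s \<in> V - X" "t \<noteq> s" by blast
    then show "s \<in> E `` {t}"
      using assms(1,4,6) unfolding clique_outside_def by cases blast+
  qed
  then have "card (insert y (V - X - {t})) \<le> deg E t"
    unfolding deg_def using finE by (intro card_mono) auto
  moreover have "card (insert y (V - X - {t})) = card (V - X)"
    using assms finV card_Suc_Diff1[of "V - X" t] by simp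
  ultimately have t: "card V \<le> deg E' t + m + 1"
    using cardVX deg_le'[of t] by simp
  have "t \<noteq> x" "t \<in> V" "x \<in> V" using assms XV by auto
  then have "(t, x) \<in> E'" using sat[of t x] t deg_le'[of x] assms(3) by fastforce
  then have "t \<in> E' `` {x}" using E'_sym by blast
  moreover have "E `` {x} = E' `` {x}"
    using sub finE' deg'X[OF assms(2)] assms(3) unfolding deg_def
    by (intro card_seteq) auto
  ultimately show ?thesis using E_sym by blast
qed

text \<open>By \<open>adjacent_low_degree\<close>, a neighbour of any vertex of \<open>X\<close> is
  a neighbour of every vertex of \<open>X - {w}\<close>. Hence these share one neighbourhood
  \<open>T\<close>, and the neighbourhood of \<open>w\<close> lies inside it.\<close>

lemma split_like_of_clique_indep:
  assumes "clique_outside" "indep" and w: "w \<in> X" "deg E w = k"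
    and deg: "\<And>x. x \<in> X - {w} \<Longrightarrow> deg E x = m" and m: "1 \<le> m"
  shows "split_like m k V E"
proof -
  have "X \<noteq> {w}" using cardX m by auto
  then obtain x0 where x0: "x0 \<in> X - {w}" using w by blast
  define T where "T = E `` {x0}"
  define N where "N = E `` {w}"
  have out: "v \<in> V - X" if "u \<in> X" "(u, v) \<in> E" for u v
    using that \<open>indep\<close> E_V[of u v] unfolding indep_def by blast
  have nb: "E `` {u} \<subseteq> E `` {x}" if "x \<in> X - {w}" "u \<in> X" for u x
  proof
    fix t assume "t \<in> E `` {u}"
    then have "(u, t) \<in> E" by simp
    then have "(t, x) \<in> E"
      using that out[of u t] E_sym deg by (intro adjacent_low_degree[OF assms(1), of x t u]) auto
    then show "t \<in> E `` {x}" using E_sym by blast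
  qed
  have NT: "N \<subseteq> T" unfolding N_def T_def using nb x0 w by blast
  have T: "E `` {x} = T" if "x \<in> X - {w}" for x
    unfolding T_def using nb that x0 by blast
  have "E = split_arcs V X T N w"
  proof (rule equalityI; rule subrelI)
    fix u v assume uv: "(u, v) \<in> E"
    then have vu: "(v, u) \<in> E" by (rule E_sym)
    have *: "b \<in> T \<and> (a = w \<longrightarrow> b \<in> N)" if "a \<in> X" "(a, b) \<in> E" for a b
    proof (cases "a = w")
      case True
      then show ?thesis using that NT unfolding N_def by blast
    next
      case False
      then show ?thesis using that T[of a] by blast
    qed
    show "(u, v) \<in> split_arcs V X T N w"
      using *[OF _ uv] *[OF _ vu] E_V[OF uv] uv E_irrefl by (auto simp: split_arcs_def)
  next
    fix u v assume uv: "(u, v) \<in> split_arcs V X T N w"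
    have *: "(a, b) \<in> E" if "a \<in> X" "b \<in> T" "a = w \<longrightarrow> b \<in> N" for a b
    proof (cases "a = w")
      case True
      then show ?thesis using that by (simp add: N_def)
    next
      case False
      then have "b \<in> E `` {a}" using that T[of a] by blast
      then show ?thesis by simp
    qed
    consider "u \<in> X" | "v \<in> X" | "u \<in> V - X" "v \<in> V - X" using uv by (auto simp: split_arcs_def)
    then show "(u, v) \<in> E"
    proof cases
      case 1
      then show ?thesis using uv by (intro *) (auto simp: split_arcs_def)
    next
      case 2
      then have "(v, u) \<in> E" using uv by (intro *) (auto simp: split_arcs_def)
      then show ?thesis by (rule E_sym)
    next
      case 3
      then show ?thesis using uv assms(1) by (auto simp: split_arcs_def clique_outside_def)
    qed
  qed
  moreover have "T \<subseteq> V" "X \<inter> T = {}" using out x0 E_V unfolding T_def by blast+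
  moreover have "card T = m" "card N = k" using deg[OF x0] w by (simp_all add: T_def N_def deg_def)
  ultimately show ?thesis
    unfolding split_like_def using XV NT w cardX by blast
qed

end

section \<open>The cost of a separating set\<close>

locale separated_graph = saturated_supergraph V E E' X m
  for V :: "'a set" and E E' X m +
  fixes S A B :: "'a set" and k :: nat
  assumes parts: "V = S \<union> A \<union> B" "S \<inter> A = {}" "S \<inter> B = {}" "A \<inter> B = {}"
    and sep: "\<And>a b. a \<in> A \<Longrightarrow> b \<in> B \<Longrightarrow> (a, b) \<notin> E"
    and cardS: "card S = k" and k: "1 \<le> k" "k \<le> m"
begin

lemma finSAB: "finite S" "finite A" "finite B"
  using finV parts(1) by auto

lemma nbrs_A: "x \<in> A \<Longrightarrow> E `` {x} \<subseteq> A \<union> S"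
  using sep E_V parts by blast

text \<open>Here \<open>u\<close> plays the role of the vertex of degree \<open>k\<close> in the independent set \<open>X \<union> {u}\<close>.\<close>

lemma split_like_pendant_part:
  assumes n: "card V = 2 * m + 2" and ind: indep and deg: "\<And>x. x \<in> X \<Longrightarrow> deg E x = m"
    and SX: "S \<subseteq> V - X" and A: "A = {u}" "u \<notin> X"
    and inner: "\<And>s t. s \<in> V - X \<Longrightarrow> t \<in> V - X \<Longrightarrow> s \<noteq> t \<Longrightarrow>
      \<not> (s \<in> A \<and> t \<in> B) \<Longrightarrow> \<not> (s \<in> B \<and> t \<in> A) \<Longrightarrow> (s, t) \<in> E"
  shows "split_like m k V E"
proof -
  define T where "T = V - X - {u}"
  have uV: "u \<in> V" using A parts by auto
  have cardT: "card T = m" using cardVX n A uV finV by (simp add: T_def)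
  have XB: "X \<subseteq> B" using SX XV parts A by auto
  have Xu: "(x, u) \<notin> E" "(u, x) \<notin> E" if "x \<in> X" for x
    using sep[of u x] XB that A E_sym[of x u] by auto
  have nbX: "E `` {x} = T" if "x \<in> X" for x
  proof (rule card_seteq)
    show "finite T" using finV by (simp add: T_def)
    show "E `` {x} \<subseteq> T"
      using that Xu ind E_V unfolding T_def indep_def by blast
    show "card T \<le> card (E `` {x})" using deg[OF that] cardT by (simp add: deg_def)
  qed
  have nbu: "E `` {u} = S"
  proof
    show "E `` {u} \<subseteq> S" using nbrs_A[of u] A E_irrefl by auto
    show "S \<subseteq> E `` {u}" using inner[of u] SX A uV parts by auto
  qed
  have "X \<noteq> {}" using cardX by auto
  then obtain z where z: "z \<in> X" by blast
  \<comment> \<open>Together \<open>X\<close> and \<open>u\<close> form an independent set of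
    \<open>m + 2\<close> vertices, one too many. An arbitrary \<open>z\<close> is exempted and
    becomes the one-vertex clique outside \<open>X'\<close> and \<open>T\<close>; its neighbourhood
    \<open>T\<close> fits both roles.\<close>
  define X' where "X' = insert u (X - {z})"
  have "card X' = m + 1" using z A finX cardX by (simp add: X'_def)
  moreover have "S \<subseteq> T" using SX A parts by (auto simp: T_def)
  moreover have "X' \<subseteq> V" "T \<subseteq> V" "X' \<inter> T = {}" "u \<in> X'"
    using XV uV by (auto simp: X'_def T_def)
  moreover have "E = split_arcs V X' T S u"
  proof -
    have iff: "(s, t) \<in> E \<longleftrightarrow> s \<noteq> t \<and> (s \<in> X' \<longrightarrow> t \<in> T \<and> (s = u \<longrightarrow> t \<in> S)) \<and>
      (t \<in> X' \<longrightarrow> s \<in> T \<and> (t = u \<longrightarrow> s \<in> S))" if st: "s \<in> V" "t \<in> V" for s t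
    proof -
      have Xl: "(a, b) \<in> E \<longleftrightarrow> b \<in> T" if "a \<in> X" for a b using nbX[OF that] by blast
      have Xr: "(b, a) \<in> E \<longleftrightarrow> b \<in> T" if "a \<in> X" for a b using Xl[OF that] E_sym by blast
      have ul: "(u, b) \<in> E \<longleftrightarrow> b \<in> S" for b using nbu by blast
      have ur: "(b, u) \<in> E \<longleftrightarrow> b \<in> S" for b using ul E_sym by blast
      have TT: "(s, t) \<in> E" if "s \<in> T" "t \<in> T" "s \<noteq> t"
        using inner[of s t] that A unfolding T_def by blast
      have cases: "a \<in> X \<or> a = u \<or> a \<in> T" if "a \<in> V" for a using that by (auto simp: T_def)
      have disj: "u \<notin> T" "a \<in> X \<Longrightarrow> a \<notin> T" for a by (auto simp: T_def)
      have ST: "S \<subseteq> T" by fact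
      consider "s \<in> X" | "t \<in> X" | "s = u" | "t = u" | "s \<in> T" "t \<in> T"
        using cases st by blast
      then show ?thesis
      proof cases
        case 1
        then show ?thesis using Xl[of s t] disj ST A(2) cases[OF st(2)]
          unfolding X'_def by blast
      next
        case 2
        then show ?thesis using Xr[of t s] disj ST A(2) cases[OF st(1)]
          unfolding X'_def by blast
      next
        case 3
        then show ?thesis using ul[of t] disj ST A(2)
          unfolding X'_def by blast
      next
        case 4
        then show ?thesis using ur[of s] disj ST A(2)
          unfolding X'_def by blast
      next
        case 5
        then show ?thesis using TT disj E_irrefl
          unfolding X'_def by blast
      qed
    qed
    show ?thesis
    proof (rule equalityI; rule subrelI)
      fix s t assume "(s, t) \<in> E"
      then show "(s, t) \<in> split_arcs V X' T S u"
        using iff[of s t] E_V[of s t] unfolding split_arcs_def by blast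
    next
      fix s t assume "(s, t) \<in> split_arcs V X' T S u"
      then show "(s, t) \<in> E" using iff[of s t] unfolding split_arcs_def by blast
    qed
  qed
  ultimately show ?thesis
    unfolding split_like_def using cardT cardS by blast
qed

lemma swap_parts: "separated_graph V E E' X m S B A k"
proof
  show "V = S \<union> B \<union> A" using parts(1) by auto
  show "(a, b) \<notin> E" if "a \<in> B" "b \<in> A" for a b using sep that E_sym by blast
qed (use parts cardS k in auto)

end

text \<open>Twice the size of a \<open>split_like m k\<close> graph of order \<open>n\<close>.\<close>

definition split_arc_count :: "nat \<Rightarrow> nat \<Rightarrow> nat \<Rightarrow> nat" where
  "split_arc_count n m k = (n - m - 1) * (n - m - 2) + 2 * (m * m + k)"

context separated_graph
begin

lemma sum_degX_split: "A \<subseteq> X \<Longrightarrow> (\<Sum>x\<in>X. deg E x) = (\<Sum>x\<in>A. deg E x) + (\<Sum>x\<in>X - A. deg E x)"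
  using sum.subset_diff[of A X "deg E"] finX by (simp add: add.commute)

text \<open>If \<open>A\<close> or \<open>B\<close> is a single vertex outside \<open>X\<close>, the
  pendant case applies. Otherwise a vertex of \<open>X\<close> in \<open>A\<close> has all its
  \<open>m\<close> neighbours in \<open>insert u S\<close>, which forces \<open>m = k + 1\<close>.
  Both sides then consist of one vertex outside \<open>X\<close> and some vertices of
  \<open>X\<close>, and this contradicts the saturation of \<open>E'\<close>.\<close>

lemma split_like_two_outside_parts:
  assumes n: "card V = 2 * m + 2" and ind: indep and deg: "\<And>x. x \<in> X \<Longrightarrow> deg E x = m"
    and SX: "S \<subseteq> V - X" and a: "card (A - X) = 1" and b: "card (B - X) = m - k" and km: "k < m"
    and inner: "\<And>s t. s \<in> V - X \<Longrightarrow> t \<in> V - X \<Longrightarrow> s \<noteq> t \<Longrightarrow>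
      \<not> (s \<in> A \<and> t \<in> B) \<Longrightarrow> \<not> (s \<in> B \<and> t \<in> A) \<Longrightarrow> (s, t) \<in> E"
  shows "split_like m k V E"
proof -
  obtain u where u: "A - X = {u}" using a by (auto simp: card_1_singleton_iff)
  show ?thesis
  proof (cases "X \<inter> A = {}")
    case True
    then have "A = {u}" "u \<notin> X" using u by auto
    then show ?thesis using split_like_pendant_part[OF n ind deg SX _ _ inner] by blast
  next
    case False
    have nbXA: "E `` {x} \<subseteq> insert u S" if "x \<in> X \<inter> A" for x
      using nbrs_A[of x] that ind u by (auto simp: indep_def)
    obtain x where x: "x \<in> X \<inter> A" using False by blast
    have "m \<le> card (insert u S)"
      using card_mono[OF _ nbXA[OF x]] finSAB deg[of x] x by (simp add: deg_def)
    also have "\<dots> \<le> k + 1" using cardS finSAB by (simp add: card_insert_if)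
    finally have m: "m = k + 1" using km by simp
    then have b1: "card (B - X) = 1" using b by simp
    then obtain v where v: "B - X = {v}" by (auto simp: card_1_singleton_iff)
    interpret swap: separated_graph V E E' X m S B A k by (rule swap_parts)
    show ?thesis
    proof (cases "X \<inter> B = {}")
      case True
      then have "B = {v}" "v \<notin> X" using v by auto
      moreover have "(s, t) \<in> E" if "s \<in> V - X" "t \<in> V - X" "s \<noteq> t"
        "\<not> (s \<in> B \<and> t \<in> A)" "\<not> (s \<in> A \<and> t \<in> B)" for s t
        using inner that by blast
      ultimately show ?thesis using swap.split_like_pendant_part[OF n ind deg SX] by blast
    next
      case False
      have nbXB: "E `` {x} \<subseteq> insert v S" if "x \<in> X \<inter> B" for x
        using swap.nbrs_A[of x] that ind v by (auto simp: indep_def)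
      have notS: "u \<notin> S" "v \<notin> S" using u v parts by auto
      have full: "E `` {x} = insert z S"
        if "x \<in> X" "E `` {x} \<subseteq> insert z S" "z \<notin> S" for x z
        using that deg[of x] cardS finSAB m by (intro card_seteq) (auto simp: deg_def)
      have uA: "u \<in> A" "u \<in> V - X" and vB: "v \<in> B" "v \<in> V - X" using u v parts by auto
      have Su: "S \<union> (X \<inter> A) \<subseteq> E `` {u}"
      proof -
        have "(u, s) \<in> E" if "s \<in> S" for s
          using that SX uA parts by (intro inner) auto
        moreover have "(u, s) \<in> E" if "s \<in> X \<inter> A" for s
          using full[OF _ nbXA[OF that] notS(1)] that E_sym by blast
        ultimately show ?thesis by blast
      qed
      have Sv: "S \<union> (X \<inter> B) \<subseteq> E `` {v}"
      proof -
        have "(v, s) \<in> E" if "s \<in> S" for s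
          using that SX vB parts by (intro inner) auto
        moreover have "(v, s) \<in> E" if "s \<in> X \<inter> B" for s
          using full[OF _ nbXB[OF that] notS(2)] that E_sym by blast
        ultimately show ?thesis by blast
      qed
      have XAB: "X = (X \<inter> A) \<union> (X \<inter> B)" using SX XV parts by auto
      have "card X = card (X \<inter> A) + card (X \<inter> B)"
        by (subst XAB, rule card_Un_disjoint) (use finSAB parts in auto)
      then have pq: "card (X \<inter> A) + card (X \<inter> B) = k + 2" using cardX m by simp
      have cu: "card (S \<union> (X \<inter> A)) = k + card (X \<inter> A)"
        using cardS finSAB parts by (subst card_Un_disjoint) auto
      have cv: "card (S \<union> (X \<inter> B)) = k + card (X \<inter> B)"
        using cardS finSAB parts by (subst card_Un_disjoint) auto
      have du: "k + card (X \<inter> A) \<le> deg E' u"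
        using card_mono[OF finE Su] cu deg_le'[of u] by (simp add: deg_def)
      have dv: "k + card (X \<inter> B) \<le> deg E' v"
        using card_mono[OF finE Sv] cv deg_le'[of v] by (simp add: deg_def)
      have uv: "u \<noteq> v" using uA vB parts by auto
      \<comment> \<open>The two degrees add up to at least \<open>3 * k + 2\<close>, while
        \<open>sat\<close> allows \<open>2 * k + 2\<close> to a non-adjacent pair.\<close>
      have "(u, v) \<in> E'"
      proof (rule ccontr)
        assume "(u, v) \<notin> E'"
        then have "deg E' u + deg E' v + 2 \<le> card V" using sat uA vB uv by blast
        then show False using du dv pq n m k by linarith
      qed
      then have "insert v (S \<union> (X \<inter> A)) \<subseteq> E' `` {u}" using Su sub by blast
      then have "card (insert v (S \<union> (X \<inter> A))) \<le> deg E' u"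
        unfolding deg_def by (rule card_mono[OF finE'])
      then have du': "k + card (X \<inter> A) + 1 \<le> deg E' u"
        using cu notS vB finSAB by simp
      obtain y where y: "y \<in> X \<inter> B" using False by blast
      have "card (X \<inter> A) \<ge> 1" using x finSAB
        by (metis One_nat_def Suc_leI card_gt_0_iff empty_iff finite_Int)
      \<comment> \<open>With \<open>v\<close> as an additional neighbour, \<open>u\<close> has
        degree at least \<open>k + 2\<close> in \<open>E'\<close>, and \<open>y\<close> has at least
        \<open>k + 1\<close>: again too much for a non-adjacent pair. But \<open>u\<close> lies
        across the separation, so it is a new neighbour of \<open>y\<close>, whose \<open>m\<close>
        places are already taken.\<close>
      have "(u, y) \<in> E'"
      proof (rule ccontr)
        assume "(u, y) \<notin> E'"
        moreover have "u \<noteq> y" "y \<in> V" using y u XV by auto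
        ultimately have "deg E' u + deg E' y + 2 \<le> card V" using sat uA by blast
        moreover have "m \<le> deg E' y" using deg_le'[of y] deg[of y] y by simp
        ultimately show False using du' n m \<open>card (X \<inter> A) \<ge> 1\<close> by linarith
      qed
      then have "insert u (E `` {y}) \<subseteq> E' `` {y}" using sub E'_sym by blast
      then have "card (insert u (E `` {y})) \<le> deg E' y"
        unfolding deg_def by (rule card_mono[OF finE'])
      moreover have "u \<notin> E `` {y}" using swap.sep[of y u] y uA by blast
      ultimately have "m + 1 \<le> deg E' y" using finE deg[of y] y by (simp add: deg_def)
      then show ?thesis using deg'X[of y] y by simp
    qed
  qed
qed

text \<open>The separation removes \<open>2 * (a * b)\<close> arcs from the clique on
  \<open>V - X\<close>. Since \<open>a\<close> and \<open>b\<close> are positive,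
  \<open>a * b\<close> is at least \<open>a + b - 1\<close>; the cut covers at most \<open>k\<close>
  of the at least \<open>m + 1\<close> vertices of \<open>V - X\<close>, so this is at least
  \<open>m - k\<close>.\<close>

lemma bound_two_outside_parts:
  assumes ne: "A - X \<noteq> {}" "B - X \<noteq> {}"
  shows "card E \<le> split_arc_count (card V) m k"
    and "card E = split_arc_count (card V) m k \<Longrightarrow> split_like m k V E"
proof -
  define a b r where "a = card (A - X)" and "b = card (B - X)" and "r = card (V - X)"
  define R where "R = r * (r - 1)"
  let ?D = "{(u, v). u \<in> V - X \<and> v \<in> V - X \<and> u \<noteq> v}"
  let ?C = "(A - X) \<times> (B - X) \<union> (B - X) \<times> (A - X)"
  have finD: "finite ?D" using finV by (auto intro: finite_subset[of _ "V \<times> V"])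
  have pos: "1 \<le> a" "1 \<le> b" using ne finSAB by (auto simp: a_def b_def Suc_le_eq card_gt_0_iff)
  have "card ?C = a * b + b * a"
    using finSAB parts(4) by (subst card_Un_disjoint) (auto simp: a_def b_def card_cartesian_product)
  moreover have CD: "?C \<subseteq> ?D" using parts by auto
  ultimately have cDC: "card (?D - ?C) = R - 2 * (a * b)" and "2 * (a * b) \<le> R"
    using card_Diff_subset[OF finite_subset[OF CD finD] CD] card_mono[OF finD CD]
      card_offdiagonal[of "V - X"] finV by (simp_all add: r_def R_def mult.commute[of b a])
  have sub: "inner \<subseteq> ?D - ?C" using inner_subset sep E_sym by blast
  have inn: "card inner \<le> R - 2 * (a * b)"
    using card_mono[OF _ sub] finD cDC by simp
  have "V - X = (S - X) \<union> ((A - X) \<union> (B - X))" using parts(1) by auto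
  then have r: "r \<le> card (S - X) + (a + b)"
    using card_Un_le[of "S - X" "(A - X) \<union> (B - X)"] card_Un_le[of "A - X" "B - X"]
    by (simp add: r_def a_def b_def)
  have SX: "card (S - X) \<le> k" using cardS finSAB card_mono[of S "S - X"] by auto
  have r': "r = card V - m - 1" using cardVX by (simp add: r_def)
  \<comment> \<open>Writing \<open>a\<close> and \<open>b\<close> as successors exhibits the slack
    of that estimate as \<open>a' * b'\<close>.\<close>
  obtain a' b' where ab': "a = Suc a'" "b = Suc b'" using pos by (metis Suc_le_D One_nat_def)
  have ab: "a * b = a' * b' + a' + b' + 1" by (simp add: ab')
  have abge: "a * b + k \<ge> m" using ab ab' r r' SX order by linarith
  define D e where "D = (\<Sum>x\<in>X. deg E x)" and "e = card (E \<inter> X \<times> X)"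
  have D: "D \<le> (m + 1) * m" using sum_degX[of X] cardX by (simp add: D_def)
  have cE: "card E + e = card inner + 2 * D" using card_E by (simp add: D_def e_def)
  have F: "split_arc_count (card V) m k = R + 2 * (m * m) + 2 * k"
    by (simp add: split_arc_count_def R_def r')
  have mm: "(m + 1) * m = m * m + m" by simp
  show "card E \<le> split_arc_count (card V) m k"
    using cE D inn abge \<open>2 * (a * b) \<le> R\<close> unfolding F mm by linarith
  assume eq: "card E = split_arc_count (card V) m k"
  have e0: "e = 0" and Deq: "D = (m + 1) * m" and abeq: "a * b + k = m"
    and inneq: "card inner = R - 2 * (a * b)"
    using eq cE D inn abge \<open>2 * (a * b) \<le> R\<close> unfolding F mm by linarith+
  \<comment> \<open>Equality in \<open>abge\<close> makes each of its ingredients tight: the order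
    is minimal, the cut avoids \<open>X\<close>, and one of the two sides has a single vertex
    outside \<open>X\<close>.\<close>
  have n: "card V = 2 * m + 2" and SXk: "card (S - X) = k" and "a' * b' = 0"
    using abeq ab ab' r r' SX order by linarith+
  have ind: indep using indepI e0 by (simp add: e_def)
  have deg: "deg E x = m" if "x \<in> X" for x
    by (rule sum_eq_bound_imp_eq[OF finX degX _ that]) (use Deq cardX in \<open>simp_all add: D_def\<close>)
  have "S - X = S" using SXk cardS finSAB by (intro card_subset_eq) auto
  then have SVX: "S \<subseteq> V - X" using parts by auto
  have innD: "inner = ?D - ?C"
    using sub finD inneq cDC by (intro card_subset_eq) auto
  have inner: "(s, t) \<in> E" if "s \<in> V - X" "t \<in> V - X" "s \<noteq> t"
    "\<not> (s \<in> A \<and> t \<in> B)" "\<not> (s \<in> B \<and> t \<in> A)" for s t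
  proof -
    have "(s, t) \<in> ?D - ?C" using that by blast
    then show ?thesis using innD by blast
  qed
  have km: "k < m" using abeq pos ab by linarith
  interpret swap: separated_graph V E E' X m S B A k by (rule swap_parts)
  have "a' = 0 \<or> b' = 0" using \<open>a' * b' = 0\<close> by simp
  then show "split_like m k V E"
  proof
    assume "a' = 0"
    then have "card (A - X) = 1" "card (B - X) = m - k"
      using ab' abeq by (simp_all add: a_def b_def)
    then show ?thesis using split_like_two_outside_parts[OF n ind deg SVX _ _ km inner] by blast
  next
    assume "b' = 0"
    then have "card (B - X) = 1" "card (A - X) = m - k"
      using ab' abeq by (simp_all add: a_def b_def)
    then show ?thesis using swap.split_like_two_outside_parts[OF n ind deg SVX _ _ km] inner by blast
  qed
qed

text \<open>For \<open>k = m\<close> the separation costs nothing: the plain degree count is already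
  tight, and any vertex of \<open>X\<close> can serve as \<open>w\<close>.\<close>

lemma split_like_if_all_equal:
  assumes "k = m" "card E = split_arc_count (card V) m k"
  shows "split_like m k V E"
proof -
  define r where "r = card (V - X)"
  define R where "R = r * (r - 1)"
  have r': "r = card V - m - 1" using cardVX by (simp add: r_def)
  define D e where "D = (\<Sum>x\<in>X. deg E x)" and "e = card (E \<inter> X \<times> X)"
  have D: "D \<le> (m + 1) * m" using sum_degX[of X] cardX by (simp add: D_def)
  have cE: "card E + e = card inner + 2 * D" using card_E by (simp add: D_def e_def)
  have inn: "card inner \<le> R" using card_inner_le by (simp add: r_def R_def)
  have F: "split_arc_count (card V) m k = R + 2 * ((m + 1) * m)"
    using assms(1) by (simp add: split_arc_count_def R_def r')
  have "e = 0" and "D = (m + 1) * m" and "card inner = R"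
    using assms(2) cE D inn unfolding F by linarith+
  then have ind: indep and clique: clique_outside
    using indepI clique_outsideI by (simp_all add: e_def r_def R_def)
  have deg: "deg E x = m" if "x \<in> X" for x
    by (rule sum_eq_bound_imp_eq[OF finX degX _ that]) (use \<open>D = (m + 1) * m\<close> cardX in \<open>simp_all add: D_def\<close>)
  obtain w where "w \<in> X" using cardX by (metis add_is_0 card.empty equals0I zero_neq_one)
  then show ?thesis
    using split_like_of_clique_indep[OF clique ind, of w k] deg k assms(1) by simp
qed

text \<open>Vertices of \<open>A\<close> have neighbours only in \<open>A\<close> and
  \<open>S\<close>, so \<open>DA\<close> is at most \<open>eA + p * k\<close> as well as at most
  \<open>p * m\<close>. For \<open>p = 1\<close> the first bound suffices. For larger
  \<open>p\<close> each bound is used once in \<open>2 * DA\<close>, and \<open>eA\<close> is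
  absorbed by the arcs inside \<open>X\<close> that the count subtracts.\<close>

lemma bound_part_inside:
  assumes AX: "A \<subseteq> X" and ne: "A \<noteq> {}"
  shows "card E \<le> split_arc_count (card V) m k"
    and "card E = split_arc_count (card V) m k \<Longrightarrow> split_like m k V E"
proof -
  define p q r where "p = card A" and "q = card (X - A)" and "r = card (V - X)"
  define R where "R = r * (r - 1)"
  have r': "r = card V - m - 1" using cardVX by (simp add: r_def)
  have pq: "p + q = m + 1"
    using AX finSAB finX cardX card_mono[OF finX AX] by (simp add: p_def q_def card_Diff_subset)
  have p1: "1 \<le> p" using ne finSAB by (simp add: p_def Suc_le_eq card_gt_0_iff)
  define DA DX e eA where "DA = (\<Sum>x\<in>A. deg E x)" and "DX = (\<Sum>x\<in>X - A. deg E x)"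
    and "e = card (E \<inter> X \<times> X)" and "eA = card (E \<inter> A \<times> A)"
  have cE: "card E + e = card inner + 2 * DA + 2 * DX"
    using card_E sum_degX_split[OF AX] by (simp add: DA_def DX_def e_def)
  have inn: "card inner \<le> R" using card_inner_le by (simp add: r_def R_def)
  have F: "split_arc_count (card V) m k = R + 2 * (m * m) + 2 * k"
    by (simp add: split_arc_count_def R_def r')
  have DX: "DX \<le> q * m" using sum_degX[of "X - A"] by (simp add: DX_def q_def)
  have DA: "DA \<le> p * m" using sum_degX[OF AX] by (simp add: DA_def p_def)
  have eA: "eA \<le> e"
    unfolding eA_def e_def using AX simple_graphD(2)[OF sg] by (intro card_mono) auto
  have "DA \<le> (\<Sum>x\<in>A. card (E `` {x} \<inter> A) + k)"
    unfolding DA_def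
  proof (rule sum_mono)
    fix x assume "x \<in> A"
    then have "E `` {x} \<subseteq> (E `` {x} \<inter> A) \<union> S" using nbrs_A[of x] by auto
    then have "deg E x \<le> card ((E `` {x} \<inter> A) \<union> S)"
      unfolding deg_def using finSAB by (intro card_mono) auto
    also have "\<dots> \<le> card (E `` {x} \<inter> A) + card S" by (rule card_Un_le)
    finally show "deg E x \<le> card (E `` {x} \<inter> A) + k" by (simp add: cardS)
  qed
  also have "\<dots> = eA + p * k"
    using sum_deg_Int[OF sg finSAB(2), of A] by (simp add: sum.distrib eA_def p_def)
  finally have DA': "DA \<le> eA + p * k" .
  have deg_out: "deg E x = m" if "DX = q * m" "x \<in> X - A" for x
    by (rule sum_eq_bound_imp_eq[of "X - A" "deg E"]) (use that degX finX in \<open>auto simp: DX_def q_def\<close>)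
  have main: "card E \<le> split_arc_count (card V) m k \<and>
    (card E = split_arc_count (card V) m k \<longrightarrow> split_like m k V E)"
  proof (cases "p = 1")
    case True
    then obtain w where w: "A = {w}" by (auto simp: p_def card_1_singleton_iff)
    have q: "q = m" using pq True by simp
    have eA0: "eA = 0" using w E_irrefl by (simp add: eA_def)
    define M where "M = m * m"
    have le: "DA \<le> k" "DX \<le> M" using DA' DX eA0 True q by (simp_all add: M_def)
    have FM: "split_arc_count (card V) m k = R + 2 * M + 2 * k" using F by (simp add: M_def)
    have "card E \<le> split_arc_count (card V) m k"
      using cE inn le unfolding FM by linarith
    moreover have "split_like m k V E" if eq: "card E = split_arc_count (card V) m k"
    proof -
      have "e = 0" "DA = k" "DX = m * m" "card inner = R"
        using eq cE inn le unfolding FM M_def[symmetric] by linarith+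
      then show ?thesis
        using split_like_of_clique_indep[OF clique_outsideI indepI, of w k] deg_out q w AX k
        by (simp add: e_def r_def R_def DA_def)
    qed
    ultimately show ?thesis by blast
  next
    case False
    then have p2: "2 \<le> p" using p1 by simp
    obtain j where j: "m = k + j" using k le_Suc_ex by blast
    obtain i where i: "p = i + 2" using p2 by (metis le_Suc_ex add.commute)
    \<comment> \<open>The slack of the combined estimate is \<open>(p - 2) * (m - k)\<close>,
      written with \<open>i\<close> and \<open>j\<close> to stay free of subtraction.\<close>
    have id: "2 * (q * m) + p * m + p * k + i * j = 2 * (m * m) + 2 * k"
    proof -
      have q: "int q = int k + int j - 1 - int i" using pq i j by linarith
      have "int (2 * (q * m) + p * m + p * k + i * j) = int (2 * (m * m) + 2 * k)"
        unfolding i j of_nat_add of_nat_mult q by (simp add: algebra_simps)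
      then show ?thesis by (simp only: of_nat_eq_iff)
    qed
    have "card E \<le> split_arc_count (card V) m k"
      using cE inn DX DA DA' eA id unfolding F by linarith
    moreover have "split_like m k V E" if eq: "card E = split_arc_count (card V) m k"
    proof (cases "k = m")
      case True
      then show ?thesis using split_like_if_all_equal eq by blast
    next
      case False
      have "i * j = 0" "e = eA" "DA = p * m" "DA = eA + p * k" "DX = q * m" "card inner = R"
        \<comment> \<open>For \<open>k < m\<close> equality is contradictory: now
          \<open>p = 2\<close>, so some \<open>z\<close> of degree \<open>m\<close> lies in
          \<open>X - A\<close>. Its degree exceeds \<open>k\<close>, giving it a neighbour
          \<open>t\<close> outside the cut and outside \<open>X\<close>, and
          \<open>adjacent_low_degree\<close> makes \<open>t\<close> a neighbour of \<open>A\<close>,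
          across the separation.\<close>
        using eq cE inn DX DA DA' eA id unfolding F by linarith+
      then have i0: "i = 0" using False j by simp
      have clique: clique_outside using clique_outsideI \<open>card inner = R\<close> by (simp add: r_def R_def)
      have degA: "deg E x = m" if "x \<in> A" for x
        by (rule sum_eq_bound_imp_eq[of A "deg E"]) (use that degX AX finSAB \<open>DA = p * m\<close> in \<open>auto simp: DA_def p_def\<close>)
      have "E \<inter> A \<times> A = E \<inter> X \<times> X"
        using AX \<open>e = eA\<close> simple_graphD(2)[OF sg] by (intro card_subset_eq) (auto simp: e_def eA_def)
      then have only: "x \<in> A" if "x \<in> X" "y \<in> X" "(x, y) \<in> E" for x y using that by blast
      have "q \<noteq> 0" using pq i i0 k False by linarith
      then obtain z where z: "z \<in> X - A" by (metis card.empty equals0I q_def)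
      have "deg E z = m" using deg_out[OF \<open>DX = q * m\<close> z] .
      then have "\<not> E `` {z} \<subseteq> S"
        using card_mono[OF finSAB(1), of "E `` {z}"] cardS k False by (auto simp: deg_def)
      then obtain t where t: "(z, t) \<in> E" "t \<notin> S" by blast
      have tX: "t \<in> V - X" using only[of z t] z t E_V by blast
      obtain x where x: "x \<in> A" using ne by blast
      have "(t, x) \<in> E"
        using adjacent_low_degree[OF clique _ degA[OF x] tX, of z] x AX z t E_sym by blast
      then have "t \<in> E `` {x}" using E_sym by blast
      then show ?thesis using nbrs_A[OF x] t tX AX by blast
    qed
    ultimately show ?thesis by blast
  qed
  then show "card E \<le> split_arc_count (card V) m k" by blast
  show "split_like m k V E" if "card E = split_arc_count (card V) m k" using main that by blast
qed

lemma separated_bound: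
  assumes "A \<noteq> {}" "B \<noteq> {}"
  shows "card E \<le> split_arc_count (card V) m k"
    and "card E = split_arc_count (card V) m k \<Longrightarrow> split_like m k V E"
proof -
  interpret swap: separated_graph V E E' X m S B A k by (rule swap_parts)
  consider "A \<subseteq> X" | "B \<subseteq> X" | "A - X \<noteq> {}" "B - X \<noteq> {}" by blast
  note cases = this
  show "card E \<le> split_arc_count (card V) m k"
    using cases bound_part_inside(1) swap.bound_part_inside(1) bound_two_outside_parts(1) assms
    by metis
  show "split_like m k V E" if "card E = split_arc_count (card V) m k"
    using cases bound_part_inside(2) swap.bound_part_inside(2) bound_two_outside_parts(2) assms that
    by metis
qed

end

section \<open>Connectivity\<close>

lemma mk_symmetric_restrict:
  assumes "sym (parcs G)"
  shows "mk_symmetric (with_proj G \<restriction> W) = \<lparr> pverts = W, parcs = parcs G \<inter> W \<times> W \<rparr>"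
  using symD[OF assms] by (fastforce simp: mk_symmetric_def induce_subgraph_def with_proj_def)

text \<open>The empty graph does not count as connected, so removing all vertices would qualify as a
  cut. Two nonempty sides therefore need a nonempty remainder as well.\<close>

lemma connected_restrict_iff:
  assumes "sym (parcs G)"
  shows "connected (with_proj G \<restriction> W) \<longleftrightarrow>
    W \<noteq> {} \<and> (\<forall>u\<in>W. \<forall>v\<in>W. (u, v) \<in> rtrancl_on W (parcs G \<inter> W \<times> W))"
  by (simp add: connected_def strongly_connected_def reachable_def mk_symmetric_restrict[OF assms])

text \<open>One side is the set of vertices reachable from a \<open>u\<close> that fails to reach
  some \<open>v\<close>; no arc leaves such a set.\<close>

lemma disconnected_restrict_separation:
  assumes "sym (parcs G)" "W \<noteq> {}" "\<not> connected (with_proj G \<restriction> W)"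
  shows "\<exists>A B. W = A \<union> B \<and> A \<inter> B = {} \<and> A \<noteq> {} \<and> B \<noteq> {} \<and> (\<forall>a\<in>A. \<forall>b\<in>B. (a, b) \<notin> parcs G)"
proof -
  let ?R = "rtrancl_on W (parcs G \<inter> W \<times> W)"
  obtain u v where uv: "u \<in> W" "v \<in> W" "(u, v) \<notin> ?R"
    using assms connected_restrict_iff by blast
  define A where "A = {x. (u, x) \<in> ?R}"
  have AW: "A \<subseteq> W" by (auto simp: A_def dest: in_rtrancl_on_in_F)
  moreover have "A \<noteq> {}" "W - A \<noteq> {}" using uv by (auto simp: A_def)
  moreover have "(a, b) \<notin> parcs G" if "a \<in> A" "b \<in> W - A" for a b
    using that AW rtrancl_on_into_rtrancl_on[of u a W "parcs G \<inter> W \<times> W" b]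
    by (auto simp: A_def)
  ultimately show ?thesis by (intro exI[of _ A] exI[of _ "W - A"]) auto
qed

lemma disconnected_restrictI:
  assumes "sym (parcs G)" "a \<in> A" "b \<in> W" "b \<notin> A" "A \<subseteq> W"
    "\<And>x y. x \<in> A \<Longrightarrow> y \<in> W - A \<Longrightarrow> (x, y) \<notin> parcs G"
  shows "\<not> connected (with_proj G \<restriction> W)"
proof
  assume "connected (with_proj G \<restriction> W)"
  then have "(a, b) \<in> rtrancl_on W (parcs G \<inter> W \<times> W)"
    using assms connected_restrict_iff by blast
  then have "b \<in> A"
  proof (induction rule: rtrancl_on_induct)
    case (step y z)
    then show ?case using assms(6)[of y z] by blast
  qed (rule assms(2))
  then show False using assms by blast
qed

lemma connected_restrict_hub:
  assumes "sym (parcs G)" "t \<in> W" "\<And>x. x \<in> W \<Longrightarrow> x \<noteq> t \<Longrightarrow> (t, x) \<in> parcs G"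
  shows "connected (with_proj G \<restriction> W)"
proof -
  let ?R = "rtrancl_on W (parcs G \<inter> W \<times> W)"
  have 1: "(t, x) \<in> ?R" if x: "x \<in> W" for x
  proof (cases "x = t")
    case True
    then show ?thesis using x by simp
  next
    case False
    then have "(t, x) \<in> parcs G \<inter> W \<times> W" using x assms(2,3) by blast
    then show ?thesis by (rule rtrancl_on_into_rtrancl_on[OF rtrancl_on_refl[OF assms(2)] _ x])
  qed
  have "sym (parcs G \<inter> W \<times> W)" using assms(1) by (auto simp: sym_def)
  then have "sym ?R" by (rule rtrancl_on_sym)
  then have "(u, v) \<in> ?R" if "u \<in> W" "v \<in> W" for u v
    using rtrancl_on_trans[OF symD[OF _ 1[OF that(1)]] 1[OF that(2)]] by blast
  then show ?thesis using assms(2) unfolding connected_restrict_iff[OF assms(1)] by blast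
qed

lemma vertex_connectivity_le:
  assumes "S \<subseteq> pverts G" "\<not> connected (with_proj G \<restriction> (pverts G - S))"
  shows "vertex_connectivity G \<le> card S"
  unfolding vertex_connectivity_def using assms by (intro Least_le) blast

lemma vertex_connectivity_witness:
  assumes "finite (pverts G)" "pverts G \<noteq> {}"
  obtains S where "S \<subseteq> pverts G" "card S = vertex_connectivity G"
    "\<not> connected (with_proj G \<restriction> (pverts G - S)) \<or> card (pverts G - S) = 1"
proof -
  obtain v where v: "v \<in> pverts G" using assms by blast
  then have "pverts G - (pverts G - {v}) = {v}" by auto
  then have "\<exists>m. \<exists>S \<subseteq> pverts G. card S = m \<and>
      (\<not> connected (with_proj G \<restriction> (pverts G - S)) \<or> card (pverts G - S) = 1)"
    by (intro exI[of _ "card (pverts G - {v})"] exI[of _ "pverts G - {v}"]) auto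
  then have "\<exists>S \<subseteq> pverts G. card S = vertex_connectivity G \<and>
      (\<not> connected (with_proj G \<restriction> (pverts G - S)) \<or> card (pverts G - S) = 1)"
    unfolding vertex_connectivity_def by (rule LeastI_ex)
  then show thesis using that by blast
qed

text \<open>Removing the neighbourhood isolates \<open>v\<close>, and the strict inequality leaves a
  further vertex from which it is cut off.\<close>

lemma vertex_connectivity_le_deg:
  assumes "pair_graph G" "v \<in> pverts G" "deg (parcs G) v + 1 < graph_order G"
  shows "vertex_connectivity G \<le> deg (parcs G) v"
proof -
  have sg: "simple_graph (pverts G) (parcs G)" using assms(1) by (simp add: pair_graph_iff_simple_graph)
  let ?N = "parcs G `` {v}"
  have N: "?N \<subseteq> pverts G" "v \<notin> ?N" "finite ?N"
    using simple_graphD(4,7,8)[OF sg] by auto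
  have "card (insert v ?N) < card (pverts G)"
    using assms(3) N by (simp add: deg_def graph_order_def)
  then obtain b where b: "b \<in> pverts G" "b \<notin> insert v ?N"
    using N by (meson card_mono finite_insert not_le subsetI)
  have "\<not> connected (with_proj G \<restriction> (pverts G - ?N))"
    by (rule disconnected_restrictI[of _ v "{v}" b])
      (use sg b N assms(2) in \<open>auto simp: simple_graph_def\<close>)
  then show ?thesis using vertex_connectivity_le[OF N(1)] by (simp add: deg_def)
qed

lemma card_parcs:
  assumes "pair_graph G"
  shows "card (parcs G) = 2 * graph_size G"
proof -
  have sg: "simple_graph (pverts G) (parcs G)" using assms by (simp add: pair_graph_iff_simple_graph)
  let ?f = "\<lambda>(u, v). {u, v}"
  have fin: "finite (parcs G)" by (rule simple_graphD(2)[OF sg])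
  have img: "?f ` parcs G = edges G" by (auto simp: edges_def)
  have "card (parcs G) = (\<Sum>e\<in>edges G. card {a \<in> parcs G. ?f a = e})"
    using sum.image_gen[OF fin, of "\<lambda>_. 1::nat" ?f] unfolding img by simp
  also have "\<dots> = (\<Sum>e\<in>edges G. 2)"
  proof (rule sum.cong[OF refl])
    fix e assume "e \<in> edges G"
    then obtain u v where uv: "(u, v) \<in> parcs G" "e = {u, v}" by (auto simp: edges_def)
    then have "u \<noteq> v" "(v, u) \<in> parcs G"
      using simple_graphD(3)[OF sg uv(1)] simple_graphD(4)[OF sg, of u] by auto
    then have "{a \<in> parcs G. ?f a = e} = {(u, v), (v, u)}"
      using uv by (auto simp: doubleton_eq_iff)
    then show "card {a \<in> parcs G. ?f a = e} = 2" using \<open>u \<noteq> v\<close> by simp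
  qed
  finally show ?thesis by (simp add: graph_size_def)
qed

theorem nontraceable_arcs_bound:
  assumes G: "nontraceable_graph n k G" and k: "1 \<le> k" and n: "2 * k + 2 \<le> n"
  obtains m where "k \<le> m" "2 * m + 2 \<le> n" "card (parcs G) \<le> split_arc_count n m k"
    "card (parcs G) = split_arc_count n m k \<Longrightarrow> split_like m k (pverts G) (parcs G)"
proof -
  let ?V = "pverts G" and ?E = "parcs G"
  have pg: "pair_graph G" and cardV: "card ?V = n" and vc: "vertex_connectivity G = k"
    and nt: "\<not> traceable G"
    using G by (auto simp: nontraceable_graph_def graph_order_def)
  have sg: "simple_graph ?V ?E" using pg by (simp add: pair_graph_iff_simple_graph)
  have finV: "finite ?V" and symE: "sym ?E" using sg by (auto simp: simple_graph_def)
  have ne: "?V \<noteq> {}" using cardV n by auto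
  have none: "\<nexists>xs. ham_path ?V ?E xs" using nt traceable_iff_ham_path[OF ne] by blast
  obtain E' where E': "simple_graph ?V E'" "?E \<subseteq> E'" "\<nexists>xs. ham_path ?V E' xs"
    and sat: "\<And>u v. u \<in> ?V \<Longrightarrow> v \<in> ?V \<Longrightarrow> u \<noteq> v \<Longrightarrow> (u, v) \<notin> E' \<Longrightarrow> deg E' u + deg E' v + 2 \<le> card ?V"
    using nontraceable_saturation[OF sg none] by blast
  obtain u X where X: "u \<in> ?V" "X \<subseteq> ?V" "card X = deg E' u + 1"
      "\<forall>x\<in>X. deg E' x \<le> deg E' u" "2 * deg E' u + 2 \<le> card ?V"
    using saturated_low_degree_set[OF E'(1,3)] sat by blast
  define m where "m = deg E' u"
  have mn: "2 * m + 2 \<le> n" using X cardV by (simp add: m_def)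
  \<comment> \<open>The vertex that realises \<open>m\<close> has degree below \<open>n - 1\<close>
    in \<open>G\<close>, so its neighbourhood is a cut and \<open>k\<close> cannot exceed
    \<open>m\<close>.\<close>
  have "deg ?E u \<le> m" using deg_mono[OF E'(1,2)] by (simp add: m_def)
  then have km: "k \<le> m"
    using vertex_connectivity_le_deg[OF pg X(1)] vc mn cardV by (simp add: graph_order_def)
  obtain S where S: "S \<subseteq> ?V" "card S = k"
    "\<not> connected (with_proj G \<restriction> (?V - S)) \<or> card (?V - S) = 1"
    using vertex_connectivity_witness[OF finV ne] vc by blast
  have "card (?V - S) = n - k" using S cardV finV by (simp add: card_Diff_subset finite_subset)
  \<comment> \<open>At least \<open>k + 2\<close> vertices survive, which rules out the single
    vertex in the definition of connectivity as well as the empty remainder.\<close>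
  then have c2: "card (?V - S) \<ge> 2" using n by simp
  have "?V - S \<noteq> {}"
  proof
    assume "?V - S = {}"
    then show False using c2 by (simp only: card.empty)
  qed
  moreover have "\<not> connected (with_proj G \<restriction> (?V - S))" using S(3) c2 by simp
  ultimately obtain A B where AB: "?V - S = A \<union> B" "A \<inter> B = {}" "A \<noteq> {}" "B \<noteq> {}"
    "\<forall>a\<in>A. \<forall>b\<in>B. (a, b) \<notin> ?E"
    using disconnected_restrict_separation[OF symE] by meson
  interpret separated_graph ?V ?E E' X m S A B k
  proof
    show "simple_graph ?V ?E" "simple_graph ?V E'" "?E \<subseteq> E'" "X \<subseteq> ?V" "card X = m + 1"
      "2 * m + 2 \<le> card ?V" "card S = k" "1 \<le> k" "k \<le> m" "A \<inter> B = {}"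
      using sg E'(1,2) X(2,3) S(2) k km AB(2) mn cardV by (simp_all add: m_def)
    show "?V = S \<union> A \<union> B" "S \<inter> A = {}" "S \<inter> B = {}" using AB(1) S(1) by auto
    show "deg E' x \<le> m" if "x \<in> X" for x using X(4) that by (simp add: m_def)
    show "(a, b) \<notin> ?E" if "a \<in> A" "b \<in> B" for a b using AB(5) that by blast
  qed (fact sat)
  show thesis using that[OF km mn] separated_bound[OF AB(3,4)] cardV by simp
qed

section \<open>The extremal graphs\<close>

text \<open>Removing the vertices of \<open>T\<close> cuts a path into at most one more segment than
  there are removed vertices, and \<open>f\<close> is constant on each segment.\<close>

lemma card_classes_of_path:
  assumes "distinct xs" "successively (\<lambda>u v. (u, v) \<in> E) xs"
    and "\<And>u v. (u, v) \<in> E \<Longrightarrow> u \<notin> T \<Longrightarrow> v \<notin> T \<Longrightarrow> f u = f v"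
  shows "card (f ` (set xs - T)) \<le> card (set xs \<inter> T) + 1"
proof -
  \<comment> \<open>The induction needs the sharper count: a path that starts in \<open>T\<close>
    has one segment less.\<close>
  have "card (f ` (set xs - T)) \<le> card (set xs \<inter> T) + (if xs = [] \<or> hd xs \<in> T then 0 else 1)"
    using assms(1,2)
  proof (induction xs)
    case Nil
    then show ?case by simp
  next
    case (Cons x xs)
    then have IH: "card (f ` (set xs - T)) \<le> card (set xs \<inter> T) + (if xs = [] \<or> hd xs \<in> T then 0 else 1)"
      and x: "x \<notin> set xs" by (auto simp: successively_Cons)
    show ?case
    proof (cases "x \<in> T")
      case True
      then have "set (x # xs) - T = set xs - T" "set (x # xs) \<inter> T = insert x (set xs \<inter> T)" by auto
      then show ?thesis using IH x True by (simp split: if_splits)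
    next
      case False
      then have 1: "set (x # xs) - T = insert x (set xs - T)" "set (x # xs) \<inter> T = set xs \<inter> T" by auto
      show ?thesis
      proof (cases "xs = [] \<or> hd xs \<in> T")
        case True
        have "card (f ` insert x (set xs - T)) \<le> card (f ` (set xs - T)) + 1"
          by (simp add: card_insert_if)
        moreover have "card (f ` (set xs - T)) \<le> card (set xs \<inter> T)" using IH True by simp
        ultimately show ?thesis using False unfolding 1 by simp
      next
        case hd: False
        have "(x, hd xs) \<in> E" using Cons.prems(2) hd by (cases xs) simp_all
        then have "f x = f (hd xs)" using assms(3) False hd by blast
        then have "f ` insert x (set xs - T) = f ` (set xs - T)"
          using hd by (auto simp: insert_absorb image_iff)
        then show ?thesis using IH hd False unfolding 1 by simp
      qed
    qed
  qed
  then show ?thesis by (simp split: if_splits)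
qed

section \<open>Size, nontraceability and connectivity of the split graphs\<close>

locale split_graph =
  fixes V :: "'a set" and X T N :: "'a set" and w :: 'a and m k :: nat and E :: "'a rel"
  assumes finV: "finite V" and XV: "X \<subseteq> V" and TV: "T \<subseteq> V" and XT: "X \<inter> T = {}"
    and NT: "N \<subseteq> T" and wX: "w \<in> X" and cardX: "card X = m + 1" and cardT: "card T = m"
    and cardN: "card N = k" and E: "E = split_arcs V X T N w" and order: "2 * m + 2 \<le> card V"
begin

lemma simple_graph: "simple_graph V E"
  unfolding E split_arcs_def simple_graph_def sym_def irrefl_def using finV by auto

lemma nbrs_w: "E `` {w} = N"
  unfolding E split_arcs_def using XV TV XT NT wX by auto

lemma nbrs_X: "x \<in> X \<Longrightarrow> x \<noteq> w \<Longrightarrow> E `` {x} = T"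
  unfolding E split_arcs_def using XV TV XT NT wX by auto

lemma card_arcs: "card E = split_arc_count (card V) m k"
proof -
  have finX: "finite X" using finV XV finite_subset by blast
  have "E \<inter> (V - X) \<times> (V - X) = {(u, v). u \<in> V - X \<and> v \<in> V - X \<and> u \<noteq> v}"
    unfolding E split_arcs_def by auto
  moreover have "card (V - X) = card V - m - 1"
    using XV finX cardX by (simp add: card_Diff_subset)
  ultimately have inner: "card (E \<inter> (V - X) \<times> (V - X)) = (card V - m - 1) * (card V - m - 2)"
    using card_offdiagonal[of "V - X"] finV by simp
  have "E \<inter> X \<times> X = {}" unfolding E split_arcs_def using XT by auto
  moreover have "(\<Sum>x\<in>X. deg E x) = m * m + k"
  proof -
    have "(\<Sum>x\<in>X. deg E x) = deg E w + (\<Sum>x\<in>X - {w}. deg E x)"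
      using finX wX by (rule sum.remove)
    also have "(\<Sum>x\<in>X - {w}. deg E x) = (\<Sum>x\<in>X - {w}. m)"
      by (rule sum.cong) (auto simp: deg_def nbrs_X cardT)
    finally show ?thesis using wX cardX finX by (simp add: deg_def nbrs_w cardN)
  qed
  ultimately show ?thesis
    using card_arcs_split[OF simple_graph XV] inner by (simp add: split_arc_count_def)
qed

text \<open>Without the \<open>m\<close> vertices of \<open>T\<close> the graph falls into
  \<open>m + 2\<close> pieces: the \<open>m + 1\<close> vertices of \<open>X\<close> and the
  remaining clique, which \<open>order\<close> keeps nonempty. A Hamilton path would leave at most
  \<open>m + 1\<close>.\<close>

lemma no_ham_path: "\<not> ham_path V E xs"
proof
  assume xs: "ham_path V E xs"
  \<comment> \<open>\<open>f\<close> names the pieces, with \<open>None\<close> for the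
    clique.\<close>
  define f where "f x = (if x \<in> X then Some x else None)" for x
  have "f u = f v" if "(u, v) \<in> E" "u \<notin> T" "v \<notin> T" for u v
    using that unfolding E split_arcs_def f_def by auto
  then have "card (f ` (V - T)) \<le> card (V \<inter> T) + 1"
    using card_classes_of_path[of xs E T f] xs by (simp add: ham_path_def)
  then have le: "card (f ` (V - T)) \<le> m + 1" using TV cardT by (simp add: Int_absorb1)
  have finX: "finite X" "finite T" using finV XV TV finite_subset by blast+
  have "card (X \<union> T) < card V"
    using card_Un_le[of X T] cardX cardT order by linarith
  then obtain c where "c \<in> V" "c \<notin> X \<union> T"
    using finX by (meson card_mono finite_UnI not_le subsetI)
  then have "insert None (Some ` X) \<subseteq> f ` (V - T)"
    using XV XT by (auto simp: f_def image_iff)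
  then have "card (insert None (Some ` X)) \<le> card (f ` (V - T))"
    using finV by (intro card_mono) auto
  also have "card (insert None (Some ` X)) = m + 2"
    using finX cardX by (subst card_insert_disjoint) (auto simp: card_image)
  finally show False using le by simp
qed

text \<open>The neighbours of \<open>w\<close> form a cut of size \<open>k\<close>. Fewer than
  \<open>k\<close> removed vertices miss a member of \<open>N\<close>, and such a vertex is adjacent
  to all others.\<close>

lemma vertex_connectivity:
  assumes G: "pverts G = V" "parcs G = E" and km: "k \<le> m"
  shows "vertex_connectivity G = k"
proof (rule antisym)
  have pg: "pair_graph G" using simple_graph G by (simp add: pair_graph_iff_simple_graph)
  show "vertex_connectivity G \<le> k"
    using vertex_connectivity_le_deg[OF pg, of w] wX XV G nbrs_w cardN order km
    by (auto simp: deg_def graph_order_def)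
  show "k \<le> vertex_connectivity G"
  proof (rule ccontr)
    assume less: "\<not> k \<le> vertex_connectivity G"
    have "pverts G \<noteq> {}" using wX XV G by auto
    then obtain S where S: "S \<subseteq> V" "card S < k"
      "\<not> connected (with_proj G \<restriction> (V - S)) \<or> card (V - S) = 1"
      using vertex_connectivity_witness[of G] less G finV by (metis not_le)
    have finS: "finite S" using S finV finite_subset by blast
    then obtain t where t: "t \<in> N" "t \<notin> S"
      using S(2) cardN by (metis card_mono not_le subsetI)
    have "(t, x) \<in> parcs G" if "x \<in> V - S" "x \<noteq> t" for x
      using that t NT TV XT unfolding G E split_arcs_def by auto
    then have "connected (with_proj G \<restriction> (V - S))"
      using simple_graph t NT TV G
      by (intro connected_restrict_hub[of _ t]) (auto simp: simple_graph_def)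
    then have "card (V - S) = 1" using S(3) by blast
    then show False using S finS km order by (simp add: card_Diff_subset)
  qed
qed

lemma nontraceable_graph:
  assumes G: "pverts G = V" "parcs G = E" and km: "k \<le> m"
  shows "nontraceable_graph (card V) k G"
proof -
  have "pverts G \<noteq> {}" using wX XV G by auto
  then show ?thesis
    using simple_graph no_ham_path vertex_connectivity[OF assms] G
    by (auto simp: nontraceable_graph_def pair_graph_iff_simple_graph graph_order_def
        traceable_iff_ham_path)
qed

end

lemma split_likeE:
  assumes "split_like m k V E" "finite V" "2 * m + 2 \<le> card V"
  obtains X T N w where "split_graph V X T N w m k E"
  using assms unfolding split_like_def split_graph_def by blast

lemma split_like_nontraceable:
  assumes "split_like m k (pverts G) (parcs G)" "finite (pverts G)" "2 * m + 2 \<le> graph_order G" "k \<le> m"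
  shows "nontraceable_graph (graph_order G) k G"
    and "card (parcs G) = split_arc_count (graph_order G) m k"
proof -
  obtain X T N w where "split_graph (pverts G) X T N w m k (parcs G)"
    using assms by (auto simp: graph_order_def elim: split_likeE)
  then interpret split_graph "pverts G" X T N w m k "parcs G" .
  show "nontraceable_graph (graph_order G) k G"
    and "card (parcs G) = split_arc_count (graph_order G) m k"
    using nontraceable_graph[OF refl refl assms(4)] card_arcs by (simp_all add: graph_order_def)
qed

text \<open>\<open>phi\<close> ranges over graphs on natural numbers, so its value has to be
  realised there.\<close>

lemma split_like_exists:
  assumes "2 * m + 2 \<le> n" "k \<le> m"
  shows "\<exists>G :: nat pair_pre_digraph. finite (pverts G) \<and> graph_order G = n \<and>
    split_like m k (pverts G) (parcs G)"
proof -
  let ?G = "\<lparr> pverts = {..<n}, parcs = split_arcs {..<n} {m..<2 * m + 1} {..<m} {..<k} m \<rparr>"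
  have "split_like m k (pverts ?G) (parcs ?G)"
    unfolding split_like_def using assms
    by (intro exI[of _ "{m..<2 * m + 1}"] exI[of _ "{..<m}"] exI[of _ "{..<k}"] exI[of _ m]) auto
  then show ?thesis by (intro exI[of _ ?G]) (auto simp: graph_order_def)
qed

section \<open>Isomorphism of split-like graphs\<close>

lemma bij_betw_matching_labels:
  assumes "finite V" "finite V'" "\<And>c. card {v \<in> V. l v = c} = card {v \<in> V'. l' v = c}"
  shows "\<exists>f. bij_betw f V V' \<and> (\<forall>v\<in>V. l' (f v) = l v)"
proof -
  have "\<exists>g. bij_betw g {v \<in> V. l v = c} {v \<in> V'. l' v = c}" for c
    using assms by (intro finite_same_card_bij) auto
  then obtain g where g: "\<And>c. bij_betw (g c) {v \<in> V. l v = c} {v \<in> V'. l' v = c}" by metis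
  define f where "f v = g (l v) v" for v
  have f: "f v \<in> V' \<and> l' (f v) = l v" if "v \<in> V" for v
    using bij_betwE[OF g[of "l v"]] that by (simp add: f_def)
  have "inj_on f V"
  proof (rule inj_onI)
    fix x y assume xy: "x \<in> V" "y \<in> V" "f x = f y"
    then have "l x = l y" using f by metis
    then show "x = y"
      using xy inj_onD[OF bij_betw_imp_inj_on[OF g[of "l x"]], of x y] by (simp add: f_def)
  qed
  moreover have "f ` V = V'"
  proof
    show "f ` V \<subseteq> V'" using f by blast
    show "V' \<subseteq> f ` V"
    proof
      fix y assume "y \<in> V'"
      then have "y \<in> g (l' y) ` {v \<in> V. l v = l' y}"
        using bij_betw_imp_surj_on[OF g[of "l' y"]] by simp
      then obtain x where "x \<in> V" "l x = l' y" "y = g (l' y) x" by blast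
      then have "y = f x" by (simp add: f_def)
      then show "y \<in> f ` V" using \<open>x \<in> V\<close> by blast
    qed
  qed
  ultimately show ?thesis using f by (intro exI[of _ f]) (simp add: bij_betw_def)
qed

text \<open>An isomorphism of digraphs maps vertices and arcs separately and may change the end
  functions. Under \<open>with_proj\<close> both graphs have \<open>fst\<close> and
  \<open>snd\<close> as ends, which forces the arc map to be \<open>map_prod f f\<close>.\<close>

lemma graph_iso_iff:
  assumes "pair_graph G"
  shows "graph_iso G H \<longleftrightarrow> (\<exists>f. bij_betw f (pverts G) (pverts H) \<and> parcs H = map_prod f f ` parcs G)"
proof
  assume "graph_iso G H"
  then obtain h where h: "pre_digraph.digraph_isomorphism (with_proj G) h"
    and H: "with_proj H = app_iso h (with_proj G)"
    by (auto simp: graph_iso_def digraph_iso_def)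
  let ?f = "iso_verts h"
  have tl: "iso_tail h = fst" "iso_head h = snd"
    using arg_cong[OF H, of tail] arg_cong[OF H, of head] by simp_all
  have V: "pverts H = ?f ` pverts G" and A: "parcs H = iso_arcs h ` parcs G"
    using arg_cong[OF H, of verts] arg_cong[OF H, of arcs] by simp_all
  have "iso_arcs h a = map_prod ?f ?f a" if "a \<in> parcs G" for a
    using h that tl by (cases a, cases "iso_arcs h a")
      (auto simp: pre_digraph.digraph_isomorphism_def)
  then have "parcs H = map_prod ?f ?f ` parcs G" using A by (metis image_cong)
  moreover have "inj_on ?f (pverts G)" using h by (simp add: pre_digraph.digraph_isomorphism_def)
  ultimately show "\<exists>f. bij_betw f (pverts G) (pverts H) \<and> parcs H = map_prod f f ` parcs G"
    using V by (auto simp: bij_betw_def)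
next
  assume "\<exists>f. bij_betw f (pverts G) (pverts H) \<and> parcs H = map_prod f f ` parcs G"
  then obtain f where f: "bij_betw f (pverts G) (pverts H)" and A: "parcs H = map_prod f f ` parcs G"
    by blast
  interpret pair_graph G by fact
  have wf: "wf_digraph (with_proj G)" by unfold_locales
  let ?h = "\<lparr> iso_verts = f, iso_arcs = map_prod f f, iso_head = snd, iso_tail = fst \<rparr>"
  have "parcs G \<subseteq> pverts G \<times> pverts G" by (auto dest: in_arcsD1 in_arcsD2)
  then have "inj_on (map_prod f f) (parcs G)"
    using map_prod_inj_on[OF bij_betw_imp_inj_on[OF f] bij_betw_imp_inj_on[OF f]]
    by (rule inj_on_subset[rotated])
  then have "pre_digraph.digraph_isomorphism (with_proj G) ?h"
    using wf f by (auto simp: pre_digraph.digraph_isomorphism_def bij_betw_def)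
  moreover have "with_proj H = app_iso ?h (with_proj G)"
    using f A by (simp add: with_proj_def app_iso_def bij_betw_def)
  ultimately show "graph_iso G H" unfolding graph_iso_def digraph_iso_def by blast
qed

text \<open>Whether two different vertices are adjacent depends only on their labels.\<close>

definition split_label :: "'a set \<Rightarrow> 'a set \<Rightarrow> 'a set \<Rightarrow> 'a \<Rightarrow> 'a \<Rightarrow> nat" where
  "split_label X T N w v =
    (if v = w then 0 else if v \<in> X then 1 else if v \<in> N then 2 else if v \<in> T then 3 else 4)"

lemma (in split_graph) card_split_label:
  "card {v \<in> V. split_label X T N w v = c} =
    (if c = 0 then 1 else if c = 1 then m else if c = 2 then k else if c = 3 then m - k
     else if c = 4 then card V - (2 * m + 1) else 0)"
proof -
  have fin: "finite X" "finite T" "finite N" using finV XV TV NT by (meson finite_subset)+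
  have "{v \<in> V. split_label X T N w v = c} =
    (if c = 0 then {w} else if c = 1 then X - {w} else if c = 2 then N else if c = 3 then T - N
     else if c = 4 then V - (X \<union> T) else {})"
    using XV TV XT NT wX by (auto simp: split_label_def)
  moreover have "card (X - {w}) = m" using wX cardX fin by simp
  moreover have "card (T - N) = m - k" using NT cardT cardN fin by (simp add: card_Diff_subset)
  moreover have "card (V - (X \<union> T)) = card V - (2 * m + 1)"
    using XV TV XT fin cardX cardT by (simp add: card_Diff_subset card_Un_disjoint mult_2)
  ultimately show ?thesis using cardN by simp
qed

text \<open>The label classes have sizes determined by \<open>m\<close>, \<open>k\<close> and the
  order, so a label-preserving bijection exists, and it preserves adjacency.\<close>

lemma split_graphs_isomorphic:
  assumes G: "split_graph (pverts G) X T N w m k (parcs G)"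
    and H: "split_graph (pverts H) X' T' N' w' m k (parcs H)"
    and n: "card (pverts G) = card (pverts H)"
  shows "graph_iso G H"
proof -
  interpret G: split_graph "pverts G" X T N w m k "parcs G" by fact
  interpret H: split_graph "pverts H" X' T' N' w' m k "parcs H" by fact
  have "card {v \<in> pverts G. split_label X T N w v = c} =
      card {v \<in> pverts H. split_label X' T' N' w' v = c}" for c
    unfolding G.card_split_label H.card_split_label n ..
  then obtain f where f: "bij_betw f (pverts G) (pverts H)"
    and l: "\<forall>v\<in>pverts G. split_label X' T' N' w' (f v) = split_label X T N w v"
    using bij_betw_matching_labels[OF G.finV H.finV] by blast
  have in_G: "v = w \<longleftrightarrow> split_label X T N w v = 0" "v \<in> X \<longleftrightarrow> split_label X T N w v \<le> 1"
    "v \<in> N \<longleftrightarrow> split_label X T N w v = 2" "v \<in> T \<longleftrightarrow> split_label X T N w v \<in> {2, 3}" for v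
    using G.XT G.NT G.wX by (auto simp: split_label_def)
  have in_H: "v = w' \<longleftrightarrow> split_label X' T' N' w' v = 0" "v \<in> X' \<longleftrightarrow> split_label X' T' N' w' v \<le> 1"
    "v \<in> N' \<longleftrightarrow> split_label X' T' N' w' v = 2" "v \<in> T' \<longleftrightarrow> split_label X' T' N' w' v \<in> {2, 3}" for v
    using H.XT H.NT H.wX by (auto simp: split_label_def)
  have fV: "f v \<in> pverts H" if "v \<in> pverts G" for v using f that by (rule bij_betw_apply)
  have f_eq: "f u = f v \<longleftrightarrow> u = v" if "u \<in> pverts G" "v \<in> pverts G" for u v
    using inj_on_eq_iff[OF bij_betw_imp_inj_on[OF f] that] .
  have arcs: "(f u, f v) \<in> parcs H \<longleftrightarrow> (u, v) \<in> parcs G" if "u \<in> pverts G" "v \<in> pverts G" for u v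
    unfolding G.E H.E split_arcs_def using that fV f_eq[OF that]
    by (simp add: in_G in_H l)
  have "parcs H = map_prod f f ` parcs G"
  proof (rule equalityI; rule subrelI)
    fix x y assume xy: "(x, y) \<in> parcs H"
    then have "x \<in> pverts H" "y \<in> pverts H" using simple_graphD(5,6)[OF H.simple_graph] by blast+
    then obtain u v where "u \<in> pverts G" "v \<in> pverts G" "x = f u" "y = f v"
      using bij_betw_imp_surj_on[OF f] by blast
    then show "(x, y) \<in> map_prod f f ` parcs G" using xy arcs by force
  next
    fix x y assume "(x, y) \<in> map_prod f f ` parcs G"
    then show "(x, y) \<in> parcs H"
      using arcs simple_graphD(5,6)[OF G.simple_graph] by auto
  qed
  moreover have "pair_graph G" using G.simple_graph by (simp add: pair_graph_iff_simple_graph)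
  ultimately show ?thesis using f by (auto simp: graph_iso_iff)
qed

lemma split_like_isomorphic:
  assumes "split_like m k (pverts G) (parcs G)" "split_like m k (pverts H) (parcs H)"
    and "finite (pverts G)" "finite (pverts H)" "graph_order G = n" "graph_order H = n" "2 * m + 2 \<le> n"
  shows "graph_iso G H"
proof -
  obtain X T N w where "split_graph (pverts G) X T N w m k (parcs G)"
    using split_likeE[OF assms(1,3)] assms(5,7) unfolding graph_order_def by blast
  moreover obtain X' T' N' w' where "split_graph (pverts H) X' T' N' w' m k (parcs H)"
    using split_likeE[OF assms(2,4)] assms(6,7) unfolding graph_order_def by blast
  ultimately show ?thesis
    using assms(5,6) unfolding graph_order_def by (intro split_graphs_isomorphic) simp_all
qed

lemma graph_iso_order:
  assumes "pair_graph G" "graph_iso G H"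
  shows "graph_order G = graph_order H"
proof -
  obtain f where "bij_betw f (pverts G) (pverts H)"
    using assms(2) unfolding graph_iso_iff[OF assms(1)] by blast
  then show ?thesis unfolding graph_order_def by (rule bij_betw_same_card)
qed

lemma split_like_graph_iso:
  assumes G: "pair_graph G" and iso: "graph_iso G H" and H: "split_like m k (pverts H) (parcs H)"
  shows "split_like m k (pverts G) (parcs G)"
proof -
  obtain f where f: "bij_betw f (pverts G) (pverts H)" and A: "parcs H = map_prod f f ` parcs G"
    using iso unfolding graph_iso_iff[OF G] by blast
  obtain X' T' N' w' where H': "X' \<subseteq> pverts H" "T' \<subseteq> pverts H" "X' \<inter> T' = {}" "N' \<subseteq> T'" "w' \<in> X'"
    "card X' = m + 1" "card T' = m" "card N' = k" "parcs H = split_arcs (pverts H) X' T' N' w'"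
    using H unfolding split_like_def by blast
  define pull where "pull Y = {v \<in> pverts G. f v \<in> Y}" for Y
  have inj: "inj_on f (pverts G)" and surj: "f ` pverts G = pverts H"
    using f by (auto simp: bij_betw_def)
  have card_pull: "card (pull Y) = card Y" if "Y \<subseteq> pverts H" for Y
  proof -
    have "f ` pull Y = Y" using that surj by (auto simp: pull_def)
    moreover have "inj_on f (pull Y)" by (rule inj_on_subset[OF inj]) (auto simp: pull_def)
    ultimately show ?thesis using card_image by metis
  qed
  have "w' \<in> f ` pverts G" unfolding surj using H'(1,5) by (rule subsetD)
  then obtain w where w: "w \<in> pverts G" "f w = w'" by auto
  have arcsV: "parcs G \<subseteq> pverts G \<times> pverts G"
    using G by (simp add: pair_graph_iff_simple_graph simple_graph_def)
  have arcs: "(u, v) \<in> parcs G \<longleftrightarrow> (f u, f v) \<in> parcs H" if "u \<in> pverts G" "v \<in> pverts G" for u v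
  proof
    assume "(u, v) \<in> parcs G"
    then show "(f u, f v) \<in> parcs H" unfolding A by (metis map_prod_imageI)
  next
    assume "(f u, f v) \<in> parcs H"
    then obtain a b where "(a, b) \<in> parcs G" "f u = f a" "f v = f b" unfolding A by auto
    moreover from this(1) have "a \<in> pverts G" "b \<in> pverts G" using arcsV by blast+
    ultimately show "(u, v) \<in> parcs G"
      using inj_onD[OF inj, of u a] inj_onD[OF inj, of v b] that by simp
  qed
  have fw: "f u = w' \<longleftrightarrow> u = w" if "u \<in> pverts G" for u
    using inj_on_eq_iff[OF inj that w(1)] w(2) by simp
  have f_eq: "f u = f v \<longleftrightarrow> u = v" if "u \<in> pverts G" "v \<in> pverts G" for u v
    using inj_on_eq_iff[OF inj that] .
  have fV: "f u \<in> pverts H" if "u \<in> pverts G" for u using f that by (rule bij_betw_apply)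
  have "(u, v) \<in> parcs G \<longleftrightarrow> (u, v) \<in> split_arcs (pverts G) (pull X') (pull T') (pull N') w" for u v
  proof (cases "u \<in> pverts G \<and> v \<in> pverts G")
    case True
    then show ?thesis
      unfolding arcs[OF conjunct1[OF True] conjunct2[OF True]] H'(9) split_arcs_def
      using fV by (simp add: pull_def fw f_eq)
  next
    case False
    then show ?thesis using arcsV unfolding split_arcs_def by blast
  qed
  then have "parcs G = split_arcs (pverts G) (pull X') (pull T') (pull N') w" by auto
  moreover have "N' \<subseteq> pverts H" using H' by blast
  ultimately show ?thesis
    unfolding split_like_def using H' card_pull w
    by (intro exI[of _ "pull X'"] exI[of _ "pull T'"] exI[of _ "pull N'"] exI[of _ w])
      (auto simp: pull_def)
qed

section \<open>The named extremal graphs as split-like graphs\<close>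

lemma star_deletion_split_like:
  assumes V: "pverts G = V" and arcs: "parcs G = split_arcs V X T T w"
    and part: "X \<subseteq> V" "T \<subseteq> V" "X \<inter> T = {}" "w \<in> X" "card X = m + 1" "card T = m"
    and fin: "finite V" and D: "D \<subseteq> {e \<in> edges G. w \<in> e}" "card D = d"
  shows "split_like m (m - d) (pverts (delete_edges G D)) (parcs (delete_edges G D))"
proof -
  define N where "N = {t \<in> T. {w, t} \<notin> D}"
  have wT: "w \<notin> T" using part by blast
  have finT: "finite T" using part fin finite_subset by blast
  \<comment> \<open>All edges at \<open>w\<close> lead to \<open>T\<close>, so deleting
    \<open>d\<close> of them amounts to choosing the \<open>d\<close> vertices of \<open>T\<close>
    that \<open>w\<close> loses.\<close>
  have "D = (\<lambda>t. {w, t}) ` (T - N)"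
  proof
    show "(\<lambda>t. {w, t}) ` (T - N) \<subseteq> D" by (auto simp: N_def)
    show "D \<subseteq> (\<lambda>t. {w, t}) ` (T - N)"
    proof
      fix e assume e: "e \<in> D"
      then obtain u v where uv: "e = {u, v}" "(u, v) \<in> split_arcs V X T T w" "w = u \<or> w = v"
        using D(1) arcs by (auto simp: edges_def)
      then obtain t where "e = {w, t}" "t \<in> T" using part by (auto simp: split_arcs_def)
      then show "e \<in> (\<lambda>t. {w, t}) ` (T - N)" using e by (auto simp: N_def)
    qed
  qed
  moreover have "inj_on (\<lambda>t. {w, t}) (T - N)" by (auto simp: inj_on_def doubleton_eq_iff)
  ultimately have "card (T - N) = d" using D(2) card_image by metis
  moreover have NT: "N \<subseteq> T" by (auto simp: N_def)
  ultimately have "card N = m - d"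
    using finT part card_mono[OF finT NT] by (simp add: card_Diff_subset finite_subset)
  moreover have "parcs (delete_edges G D) = split_arcs V X T N w"
  proof -
    have D_w: "w \<in> e" if "e \<in> D" for e using D(1) that by blast
    have "(u, v) \<in> split_arcs V X T T w \<and> {u, v} \<notin> D \<longleftrightarrow> (u, v) \<in> split_arcs V X T N w" for u v
    proof -
      consider "u = w" | "v = w" "u \<noteq> w" | "u \<noteq> w" "v \<noteq> w" by blast
      then show ?thesis
      proof cases
        case 1
        then show ?thesis using part wT by (auto simp: split_arcs_def N_def)
      next
        case 2
        then show ?thesis using part wT by (auto simp: split_arcs_def N_def insert_commute)
      next
        case 3
        then have "{u, v} \<notin> D" using D_w[of "{u, v}"] by auto
        then show ?thesis using 3 by (auto simp: split_arcs_def)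
      qed
    qed
    then show ?thesis by (auto simp: delete_edges_def arcs)
  qed
  ultimately show ?thesis
    unfolding split_like_def using part NT V by (auto simp: delete_edges_def)
qed

text \<open>The characterisations assert that some member of \<open>H1\<close> or \<open>H2\<close>
  is isomorphic to \<open>G\<close>, so these families must not be empty.\<close>

lemma star_deletions_nonempty:
  assumes "pverts G = V" "parcs G = split_arcs V X T T w"
    and "X \<subseteq> V" "T \<subseteq> V" "X \<inter> T = {}" "w \<in> X" "card T = m" "finite V" "w \<in> W" "d \<le> m"
  shows "star_deletions G W d \<noteq> {}"
proof -
  have "inj_on (\<lambda>t. {w, t}) T" by (auto simp: inj_on_def doubleton_eq_iff)
  then have "card ((\<lambda>t. {w, t}) ` T) = m" using assms(7) by (simp add: card_image)
  then obtain D where D: "D \<subseteq> (\<lambda>t. {w, t}) ` T" "card D = d"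
    using assms(10) obtain_subset_with_card_n by metis
  have "(w, t) \<in> parcs G" if "t \<in> T" for t
    unfolding assms(2) using that assms(3-6) by (auto simp: split_arcs_def)
  then have "(\<lambda>t. {w, t}) ` T \<subseteq> {e \<in> edges G. w \<in> e}" unfolding edges_def by blast
  then have "D \<subseteq> {e \<in> edges G. w \<in> e}" using D(1) by (rule subset_trans[rotated])
  then have "delete_edges G D \<in> star_deletions G W d"
    using D(2) assms(9) by (auto simp: star_deletions_def)
  then show ?thesis by blast
qed

lemma pverts_graph_operations:
  "pverts (complete_graph a) = {..<a}"
  "pverts (graph_complement G) = pverts G"
  "pverts (disjoint_union G H) = pverts G <+> pverts H"
  "pverts (graph_join G H) = pverts G <+> pverts H"
  by (simp_all add: complete_graph_def graph_complement_def disjoint_union_def graph_join_def)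

lemma parcs_complete_graph: "(u, v) \<in> parcs (complete_graph a) \<longleftrightarrow> u < a \<and> v < a \<and> u \<noteq> v"
  by (simp add: complete_graph_def)

lemma parcs_complement_complete_graph: "parcs (graph_complement (complete_graph a)) = {}"
  by (auto simp: graph_complement_def complete_graph_def)

lemma parcs_disjoint_union:
  "(Inl a, Inl a') \<in> parcs (disjoint_union G H) \<longleftrightarrow> (a, a') \<in> parcs G"
  "(Inr b, Inr b') \<in> parcs (disjoint_union G H) \<longleftrightarrow> (b, b') \<in> parcs H"
  "(Inl a, Inr b) \<notin> parcs (disjoint_union G H)"
  "(Inr b, Inl a) \<notin> parcs (disjoint_union G H)"
  by (auto simp: disjoint_union_def)

lemma parcs_graph_join:
  "(Inl a, Inl a') \<in> parcs (graph_join G H) \<longleftrightarrow> (a, a') \<in> parcs G"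
  "(Inr b, Inr b') \<in> parcs (graph_join G H) \<longleftrightarrow> (b, b') \<in> parcs H"
  "(Inl a, Inr b) \<in> parcs (graph_join G H) \<longleftrightarrow> a \<in> pverts G \<and> b \<in> pverts H"
  "(Inr b, Inl a) \<in> parcs (graph_join G H) \<longleftrightarrow> a \<in> pverts G \<and> b \<in> pverts H"
  by (auto simp: graph_join_def parcs_disjoint_union)

lemma parcs_join_clique_plus_independent:
  fixes m r :: nat
  defines "G \<equiv> graph_join (complete_graph m)
    (disjoint_union (complete_graph r) (graph_complement (complete_graph (m + 1))))"
  shows "parcs G = split_arcs (pverts G) (Inr ` Inr ` {..<m + 1}) (Inl ` {..<m}) (Inl ` {..<m}) w"
proof -
  have "\<forall>u v. (u, v) \<in> parcs G \<longleftrightarrow>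
    (u, v) \<in> split_arcs (pverts G) (Inr ` Inr ` {..<m + 1}) (Inl ` {..<m}) (Inl ` {..<m}) w"
    unfolding G_def split_arcs_def pverts_graph_operations split_sum_all
    by (auto simp: parcs_graph_join parcs_disjoint_union parcs_complete_graph
        parcs_complement_complete_graph pverts_graph_operations)
  then show ?thesis by auto
qed

text \<open>Of the \<open>m + 2\<close> independent vertices any one, here \<open>z\<close>, can be
  viewed as the one-vertex clique outside \<open>X\<close> and \<open>T\<close>.\<close>

lemma parcs_join_independent:
  fixes m z :: nat
  defines "G \<equiv> graph_join (complete_graph m) (graph_complement (complete_graph (m + 2)))"
  assumes "z < m + 2"
  shows "parcs G = split_arcs (pverts G) (Inr ` ({..<m + 2} - {z})) (Inl ` {..<m}) (Inl ` {..<m}) w"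
proof -
  have "\<forall>u v. (u, v) \<in> parcs G \<longleftrightarrow>
    (u, v) \<in> split_arcs (pverts G) (Inr ` ({..<m + 2} - {z})) (Inl ` {..<m}) (Inl ` {..<m}) w"
    unfolding G_def split_arcs_def pverts_graph_operations split_sum_all
    by (auto simp: parcs_graph_join parcs_complete_graph
        parcs_complement_complete_graph pverts_graph_operations)
  then show ?thesis by auto
qed

lemma split_clique_graph_split_like:
  assumes "2 * k + 2 \<le> n"
  shows "split_like k k (pverts (split_clique_graph n k)) (parcs (split_clique_graph n k))"
    and "finite (pverts (split_clique_graph n k))" "graph_order (split_clique_graph n k) = n"
proof -
  let ?G = "split_clique_graph n k"
  have V: "pverts ?G = {..<k} <+> ({..<n - 2 * k - 1} <+> {..<k + 1})"
    by (simp add: split_clique_graph_def pverts_graph_operations)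
  show "finite (pverts ?G)" by (simp add: V)
  show "graph_order ?G = n" using assms by (simp add: graph_order_def V card_Plus)
  have E: "parcs ?G = split_arcs (pverts ?G) (Inr ` Inr ` {..<k + 1}) (Inl ` {..<k}) (Inl ` {..<k}) (Inr (Inr 0))"
    unfolding split_clique_graph_def by (rule parcs_join_clique_plus_independent)
  have "card (Inr ` Inr ` {..<k + 1} :: (nat + nat + nat) set) = k + 1"
    by (simp add: card_image)
  moreover have "card (Inl ` {..<k} :: (nat + nat + nat) set) = k"
    by (simp add: card_image)
  ultimately show "split_like k k (pverts ?G) (parcs ?G)"
    unfolding split_like_def
    by (intro exI[of _ "Inr ` Inr ` {..<k + 1}"] exI[of _ "Inl ` {..<k}"] exI[of _ "Inr (Inr 0)"])
      (use E in \<open>auto simp: V\<close>)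
qed

lemma H1_split_like:
  assumes n: "n = 2 * m + 3" and k: "k \<le> m"
  shows "H1 n k \<noteq> {}"
    and "H \<in> H1 n k \<Longrightarrow> split_like m k (pverts H) (parcs H) \<and> finite (pverts H) \<and> graph_order H = n"
proof -
  let ?G = "graph_join (complete_graph m)
    (disjoint_union (complete_graph 2) (graph_complement (complete_graph (m + 1))))"
  let ?X = "Inr ` Inr ` {..<m + 1} :: (nat + nat + nat) set"
  let ?T = "Inl ` {..<m} :: (nat + nat + nat) set"
  have H1: "H1 n k = star_deletions ?G ?X (m - k)"
    using n by (simp add: H1_def)
  have part: "?X \<subseteq> pverts ?G" "?T \<subseteq> pverts ?G" "?X \<inter> ?T = {}" "card ?X = m + 1" "card ?T = m"
    "finite (pverts ?G)" by (auto simp: pverts_graph_operations card_image)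
  have E: "parcs ?G = split_arcs (pverts ?G) ?X ?T ?T w" for w
    by (rule parcs_join_clique_plus_independent)
  have "Inr (Inr 0) \<in> ?X" by simp
  then show "H1 n k \<noteq> {}"
    unfolding H1 by (intro star_deletions_nonempty[OF refl E[of "Inr (Inr 0)"] part(1-3) _ part(5,6)]) simp_all
  assume "H \<in> H1 n k"
  then obtain w D where wD: "w \<in> ?X" "D \<subseteq> {e \<in> edges ?G. w \<in> e}" "card D = m - k"
    "H = delete_edges ?G D"
    unfolding H1 star_deletions_def by blast
  have "split_like m (m - (m - k)) (pverts H) (parcs H)"
    unfolding wD(4) by (rule star_deletion_split_like[OF refl E part(1-3) wD(1) part(4-6) wD(2,3)])
  moreover have "pverts H = pverts ?G" by (simp add: wD(4) delete_edges_def)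
  ultimately show "split_like m k (pverts H) (parcs H) \<and> finite (pverts H) \<and> graph_order H = n"
    using k n by (simp add: graph_order_def pverts_graph_operations card_Plus)
qed

lemma H2_split_like:
  assumes n: "n = 2 * m + 2" and k: "k \<le> m"
  shows "H2 n k \<noteq> {}"
    and "H \<in> H2 n k \<Longrightarrow> split_like m k (pverts H) (parcs H) \<and> finite (pverts H) \<and> graph_order H = n"
proof -
  let ?G = "graph_join (complete_graph m) (graph_complement (complete_graph (m + 2)))"
  let ?X = "\<lambda>z. Inr ` ({..<m + 2} - {z}) :: (nat + nat) set"
  let ?T = "Inl ` {..<m} :: (nat + nat) set"
  have H2: "H2 n k = star_deletions ?G (Inr ` {..<m + 2}) (m - k)"
    using n by (simp add: H2_def)
  have part: "?X z \<subseteq> pverts ?G" "?T \<subseteq> pverts ?G" "?X z \<inter> ?T = {}" "card ?T = m"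
    "finite (pverts ?G)" for z by (auto simp: pverts_graph_operations card_image)
  have cardX: "card (?X z) = m + 1" if "z < m + 2" for z
    using that by (simp add: card_image)
  have E: "parcs ?G = split_arcs (pverts ?G) (?X z) ?T ?T w" if "z < m + 2" for z w
    using that by (rule parcs_join_independent)
  have "Inr 0 \<in> ?X 1" by simp
  then show "H2 n k \<noteq> {}"
    unfolding H2
    by (intro star_deletions_nonempty[OF refl E[of 1 "Inr 0"] part(1-3) _ part(4,5)]) simp_all
  assume "H \<in> H2 n k"
  then obtain i D where wD: "i < m + 2" "D \<subseteq> {e \<in> edges ?G. Inr i \<in> e}" "card D = m - k"
    "H = delete_edges ?G D"
    unfolding H2 star_deletions_def by blast
  \<comment> \<open>The exempted vertex must differ from \<open>i\<close>, since the vertex that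
    loses edges has to lie in \<open>X\<close>.\<close>
  obtain z where z: "z < m + 2" "z \<noteq> i"
    by (metis add_2_eq_Suc' lessI less_SucI zero_less_Suc nat_neq_iff)
  have iX: "Inr i \<in> ?X z" using wD(1) z by simp
  have "split_like m (m - (m - k)) (pverts H) (parcs H)"
    unfolding wD(4)
    by (rule star_deletion_split_like[OF refl E[OF z(1)] part(1-3) iX cardX[OF z(1)] part(4,5) wD(2,3)])
  moreover have "pverts H = pverts ?G" by (simp add: wD(4) delete_edges_def)
  ultimately show "split_like m k (pverts H) (parcs H) \<and> finite (pverts H) \<and> graph_order H = n"
    using k n by (simp add: graph_order_def pverts_graph_operations card_Plus)
qed

section \<open>Maximisation\<close>

text \<open>As a polynomial in \<open>m\<close> the count is
  \<open>3 * m^2 - (2 * n - 3) * m\<close> plus a term independent of \<open>m\<close>.\<close>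

lemma split_arc_count_diff:
  assumes "2 * a + 2 \<le> n" "2 * b + 2 \<le> n"
  shows "int (split_arc_count n a k) - int (split_arc_count n b k) =
    (int a - int b) * (3 * (int a + int b) - (2 * int n - 3))"
proof -
  have *: "int (n - c - 1) = int n - int c - 1" "int (n - c - 2) = int n - int c - 2"
    if "2 * c + 2 \<le> n" for c using that by linarith+
  then show ?thesis
    unfolding split_arc_count_def of_nat_add of_nat_mult *[OF assms(1)] *[OF assms(2)]
    by (simp add: algebra_simps)
qed

text \<open>If \<open>3 * (m + k)\<close> is below \<open>2 * n - 3\<close>, the left endpoint beats
  \<open>m\<close>. Otherwise \<open>3 * (m + M)\<close> is above it because \<open>k < M\<close>,
  and the right endpoint does.\<close>

lemma split_arc_count_convex:
  assumes "k < m" "m < M" "2 * M + 2 \<le> n"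
  shows "split_arc_count n m k < max (split_arc_count n k k) (split_arc_count n M k)"
proof -
  have mk: "int (split_arc_count n m k) - int (split_arc_count n k k) =
      (int m - int k) * (3 * (int m + int k) - (2 * int n - 3))"
    using assms by (intro split_arc_count_diff) auto
  have mM: "int (split_arc_count n m k) - int (split_arc_count n M k) =
      (int m - int M) * (3 * (int m + int M) - (2 * int n - 3))"
    using assms by (intro split_arc_count_diff) auto
  show ?thesis
  proof (cases "3 * (int m + int k) < 2 * int n - 3")
    case True
    then have "(int m - int k) * (3 * (int m + int k) - (2 * int n - 3)) < 0"
      using assms by (intro mult_pos_neg) auto
    then show ?thesis using mk by simp
  next
    case False
    then have "(int m - int M) * (3 * (int m + int M) - (2 * int n - 3)) < 0"
      using assms by (intro mult_neg_pos) auto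
    then show ?thesis using mM by simp
  qed
qed

locale extremal_problem =
  fixes n k M :: nat
  assumes k: "1 \<le> k" and n: "2 * k + 2 \<le> n" and M: "M = (n - 2) div 2"
begin

definition arc_max :: nat where
  "arc_max = max (split_arc_count n k k) (split_arc_count n M k)"

lemma kM: "k \<le> M" "2 * M + 2 \<le> n" using n unfolding M by linarith+

text \<open>Strict convexity excludes interior values of \<open>m\<close> at equality; at a tie of
  the endpoints either shape may occur.\<close>

lemma arcs_le_arc_max:
  assumes G: "nontraceable_graph n k G"
  shows "2 * graph_size G \<le> arc_max"
    and "2 * graph_size G = arc_max \<Longrightarrow>
      split_arc_count n k k = arc_max \<and> split_like k k (pverts G) (parcs G) \<or>
      split_arc_count n M k = arc_max \<and> split_like M k (pverts G) (parcs G)"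
proof -
  have arcs: "card (parcs G) = 2 * graph_size G"
    using G by (simp add: nontraceable_graph_def card_parcs)
  obtain m where m: "k \<le> m" "2 * m + 2 \<le> n" "2 * graph_size G \<le> split_arc_count n m k"
    "2 * graph_size G = split_arc_count n m k \<Longrightarrow> split_like m k (pverts G) (parcs G)"
    using nontraceable_arcs_bound[OF G k n] arcs by metis
  have "m \<le> M" using m(2) unfolding M by linarith
  then consider "m = k" | "m = M" | "k < m" "m < M" using m(1) by linarith
  then have "2 * graph_size G \<le> arc_max \<and> (2 * graph_size G = arc_max \<longrightarrow>
      split_arc_count n k k = arc_max \<and> split_like k k (pverts G) (parcs G) \<or>
      split_arc_count n M k = arc_max \<and> split_like M k (pverts G) (parcs G))"
  proof cases
    case 1
    have "split_arc_count n k k \<le> arc_max" by (simp add: arc_max_def)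
    then show ?thesis using m(3,4) unfolding 1 by auto
  next
    case 2
    have "split_arc_count n M k \<le> arc_max" by (simp add: arc_max_def)
    then show ?thesis using m(3,4) unfolding 2 by auto
  next
    case 3
    then have "split_arc_count n m k < arc_max"
      unfolding arc_max_def by (rule split_arc_count_convex[OF _ _ kM(2)])
    then show ?thesis using m(3) by simp
  qed
  then show "2 * graph_size G \<le> arc_max"
    and "2 * graph_size G = arc_max \<Longrightarrow>
      split_arc_count n k k = arc_max \<and> split_like k k (pverts G) (parcs G) \<or>
      split_arc_count n M k = arc_max \<and> split_like M k (pverts G) (parcs G)"
    by blast+
qed

lemma arc_max_attained:
  assumes "split_like m k (pverts G) (parcs G)" "finite (pverts G)" "graph_order G = n"
    and m: "m = k \<or> m = M" "split_arc_count n m k = arc_max"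
  shows "nontraceable_graph n k G" and "2 * graph_size G = arc_max"
proof -
  have "2 * m + 2 \<le> n" "k \<le> m" using m(1) n kM by auto
  then have nt: "nontraceable_graph n k G" and "card (parcs G) = arc_max"
    using split_like_nontraceable[of m k G] assms by simp_all
  then show "nontraceable_graph n k G" and "2 * graph_size G = arc_max"
    by (simp_all add: nontraceable_graph_def card_parcs)
qed

lemma phi_eq: "2 * phi n k = arc_max"
proof -
  obtain m where m: "m = k \<or> m = M" "split_arc_count n m k = arc_max"
    unfolding arc_max_def by (metis max_def)
  then have "2 * m + 2 \<le> n" "k \<le> m" using n kM by auto
  then obtain G :: "nat pair_pre_digraph" where G: "finite (pverts G)" "graph_order G = n"
    "split_like m k (pverts G) (parcs G)" using split_like_exists by blast
  have "nontraceable_graph n k G" and size: "2 * graph_size G = arc_max"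
    by (rule arc_max_attained[OF G(3,1,2) m])+
  have le: "graph_size H \<le> graph_size G" if "nontraceable_graph n k H" for H :: "nat pair_pre_digraph"
    using arcs_le_arc_max(1)[OF that] size by linarith
  have "phi n k = graph_size G"
    unfolding phi_def
  proof (rule Max_eqI)
    show "finite {graph_size H |H :: nat pair_pre_digraph. nontraceable_graph n k H}"
      by (rule finite_subset[of _ "{..graph_size G}"]) (use le in auto)
  qed (use le \<open>nontraceable_graph n k G\<close> in auto)
  then show ?thesis using size by simp
qed

text \<open>The arc bound holds for every vertex type, so the maximum over graphs on natural numbers
  also governs \<open>G\<close>.\<close>

lemma phi_attained_by_iff:
  assumes "pair_graph G"
  shows "phi_attained_by n k G \<longleftrightarrow> graph_order G = n \<and>
    (split_arc_count n k k = arc_max \<and> split_like k k (pverts G) (parcs G) \<or>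
     split_arc_count n M k = arc_max \<and> split_like M k (pverts G) (parcs G))"
    (is "?L \<longleftrightarrow> graph_order G = n \<and> ?R")
proof
  assume L: ?L
  then have "nontraceable_graph n k G" "2 * graph_size G = arc_max"
    using phi_eq by (simp_all add: phi_attained_by_def)
  then show "graph_order G = n \<and> ?R"
    using arcs_le_arc_max(2) by (auto simp: nontraceable_graph_def)
next
  assume R: "graph_order G = n \<and> ?R"
  have "finite (pverts G)" using assms by (simp add: pair_graph_iff_simple_graph simple_graph_def)
  then have "nontraceable_graph n k G" "2 * graph_size G = arc_max"
    using R arc_max_attained[of _ G] by blast+
  then show ?L using phi_eq by (simp add: phi_attained_by_def)
qed

lemma graph_iso_split_like_iff:
  assumes "pair_graph G" "split_like m k (pverts H) (parcs H)" "finite (pverts H)"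
    "graph_order H = n" "2 * m + 2 \<le> n"
  shows "graph_iso G H \<longleftrightarrow> graph_order G = n \<and> split_like m k (pverts G) (parcs G)"
proof
  assume "graph_iso G H"
  then show "graph_order G = n \<and> split_like m k (pverts G) (parcs G)"
    using graph_iso_order split_like_graph_iso assms by metis
next
  assume "graph_order G = n \<and> split_like m k (pverts G) (parcs G)"
  moreover have "finite (pverts G)"
    using assms(1) by (simp add: pair_graph_iff_simple_graph simple_graph_def)
  ultimately show "graph_iso G H" using split_like_isomorphic assms by blast
qed

lemma graph_iso_split_clique_iff:
  assumes "pair_graph G"
  shows "graph_iso G (split_clique_graph n k) \<longleftrightarrow>
    graph_order G = n \<and> split_like k k (pverts G) (parcs G)"
  using graph_iso_split_like_iff[OF assms split_clique_graph_split_like[OF n] n] .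

lemma graph_iso_family_iff:
  assumes "pair_graph G" "\<H> \<noteq> {}"
    "\<And>H. H \<in> \<H> \<Longrightarrow> split_like M k (pverts H) (parcs H) \<and> finite (pverts H) \<and> graph_order H = n"
  shows "(\<exists>H\<in>\<H>. graph_iso G H) \<longleftrightarrow> graph_order G = n \<and> split_like M k (pverts G) (parcs G)"
  using graph_iso_split_like_iff[OF assms(1) _ _ _ kM(2)] assms(2,3) by blast

lemma graph_iso_H1_iff:
  assumes "pair_graph G" "odd n"
  shows "(\<exists>H\<in>H1 n k. graph_iso G H) \<longleftrightarrow> graph_order G = n \<and> split_like M k (pverts G) (parcs G)"
proof -
  have "n = 2 * M + 3" using assms(2) n unfolding M by presburger
  note H1 = H1_split_like[OF this kM(1)]
  show ?thesis by (rule graph_iso_family_iff[OF assms(1) H1])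
qed

lemma graph_iso_H2_iff:
  assumes "pair_graph G" "even n"
  shows "(\<exists>H\<in>H2 n k. graph_iso G H) \<longleftrightarrow> graph_order G = n \<and> split_like M k (pverts G) (parcs G)"
proof -
  have "n = 2 * M + 2" using assms(2) n unfolding M by presburger
  note H2 = H2_split_like[OF this kM(1)]
  show ?thesis by (rule graph_iso_family_iff[OF assms(1) H2])
qed

text \<open>The thresholds come from here: with \<open>n = 2 * M + 3\<close> the second factor
  vanishes at \<open>M = 3 * k - 3\<close>, that is \<open>n = 6 * k - 3\<close>; with
  \<open>n = 2 * M + 2\<close> it vanishes at \<open>M = 3 * k - 1\<close>, that is
  \<open>n = 6 * k\<close>.\<close>

lemma endpoint_diff:
  "odd n \<Longrightarrow> int (split_arc_count n k k) - int (split_arc_count n M k) =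
    (int M - int k) * (int M + 3 - 3 * int k)"
  "even n \<Longrightarrow> int (split_arc_count n k k) - int (split_arc_count n M k) =
    (int M - int k) * (int M + 1 - 3 * int k)"
proof -
  have d: "int (split_arc_count n k k) - int (split_arc_count n M k) =
      (int k - int M) * (3 * (int k + int M) - (2 * int n - 3))"
    using n kM by (intro split_arc_count_diff) auto
  show "int (split_arc_count n k k) - int (split_arc_count n M k) =
    (int M - int k) * (int M + 3 - 3 * int k)" if "odd n"
  proof -
    have "int n = 2 * int M + 3" using that n unfolding M by presburger
    then show ?thesis unfolding d by (simp add: algebra_simps)
  qed
  show "int (split_arc_count n k k) - int (split_arc_count n M k) =
    (int M - int k) * (int M + 1 - 3 * int k)" if "even n"
  proof -
    have "int n = 2 * int M + 2" using that n unfolding M by presburger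
    then show ?thesis unfolding d by (simp add: algebra_simps)
  qed
qed

lemma endpoints_ge:
  assumes "odd n \<and> n \<ge> 6 * k - 3 \<or> even n \<and> n \<ge> 6 * k"
  shows "split_arc_count n M k \<le> split_arc_count n k k"
proof -
  have "0 \<le> int (split_arc_count n k k) - int (split_arc_count n M k)"
  proof (cases "odd n")
    case True
    then have "int M + 3 - 3 * int k \<ge> 0" using assms n unfolding M by presburger
    then show ?thesis unfolding endpoint_diff(1)[OF True] using kM by simp
  next
    case False
    then have ev: "even n" by simp
    then have "int M + 1 - 3 * int k \<ge> 0" using assms n unfolding M by presburger
    then show ?thesis unfolding endpoint_diff(2)[OF ev] using kM by simp
  qed
  then show ?thesis by simp
qed

text \<open>In the degenerate case \<open>M = k\<close> the endpoints coincide, and with them the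
  two shapes, so no strict inequality can be had or is wanted.\<close>

lemma endpoints_gt:
  assumes "odd n \<and> n \<ge> 6 * k - 1 \<or> even n \<and> n \<ge> 6 * k + 2"
  shows "M = k \<or> split_arc_count n M k < split_arc_count n k k"
proof (rule disjCI)
  assume "\<not> split_arc_count n M k < split_arc_count n k k"
  then have le: "int (split_arc_count n k k) - int (split_arc_count n M k) \<le> 0" by simp
  have "(int M - int k) \<le> 0"
  proof (cases "odd n")
    case True
    then have "int M + 3 - 3 * int k > 0" using assms n unfolding M by presburger
    then show ?thesis using le unfolding endpoint_diff(1)[OF True] by (simp add: mult_le_0_iff)
  next
    case False
    then have ev: "even n" by simp
    then have "int M + 1 - 3 * int k > 0" using assms n unfolding M by presburger
    then show ?thesis using le unfolding endpoint_diff(2)[OF ev] by (simp add: mult_le_0_iff)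
  qed
  then show "M = k" using kM by simp
qed

lemma endpoints_lt:
  assumes "odd n \<and> n \<le> 6 * k - 5 \<or> even n \<and> n \<le> 6 * k - 2"
  shows "M = k \<or> split_arc_count n k k < split_arc_count n M k"
proof (rule disjCI)
  assume "\<not> split_arc_count n k k < split_arc_count n M k"
  then have ge: "0 \<le> int (split_arc_count n k k) - int (split_arc_count n M k)" by simp
  have "(int M - int k) \<le> 0"
  proof (cases "odd n")
    case True
    then have "int M + 3 - 3 * int k < 0" using assms n unfolding M by presburger
    then show ?thesis using ge unfolding endpoint_diff(1)[OF True] by (simp add: zero_le_mult_iff)
  next
    case False
    then have ev: "even n" by simp
    then have "int M + 1 - 3 * int k < 0" using assms n unfolding M by presburger
    then show ?thesis using ge unfolding endpoint_diff(2)[OF ev] by (simp add: zero_le_mult_iff)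
  qed
  then show "M = k" using kM by simp
qed

lemma endpoints_eq:
  assumes "n = 6 * k - 3 \<or> n = 6 * k"
  shows "split_arc_count n k k = split_arc_count n M k"
proof -
  have "int (split_arc_count n k k) - int (split_arc_count n M k) = 0"
  proof (cases "odd n")
    case True
    then have "int M + 3 - 3 * int k = 0" using assms n unfolding M by presburger
    then show ?thesis unfolding endpoint_diff(1)[OF True] by simp
  next
    case False
    then have ev: "even n" by simp
    then have "int M + 1 - 3 * int k = 0" using assms n unfolding M by presburger
    then show ?thesis unfolding endpoint_diff(2)[OF ev] by simp
  qed
  then show ?thesis by simp
qed

lemma phi_large:
  assumes "odd n \<and> n \<ge> 6 * k - 3 \<or> even n \<and> n \<ge> 6 * k"
  shows "phi n k = ((n - k - 1) choose 2) + k * (k + 1)"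
proof -
  have "2 * phi n k = (n - k - 1) * (n - k - 2) + 2 * (k * k + k)"
    using phi_eq endpoints_ge[OF assms] by (simp add: arc_max_def split_arc_count_def)
  moreover have "2 * ((n - k - 1) choose 2) = (n - k - 1) * (n - k - 2)"
  proof -
    have "even (a * (a - 1))" for a :: nat by (cases a) auto
    then have "even ((n - k - 1) * (n - k - 1 - 1))" .
    moreover have "n - k - 1 - 1 = n - k - 2" by simp
    ultimately show ?thesis unfolding choose_two by (metis dvd_mult_div_cancel)
  qed
  ultimately show ?thesis by (simp add: algebra_simps)
qed

lemma phi_small:
  assumes "odd n \<and> n \<le> 6 * k - 5 \<or> even n \<and> n \<le> 6 * k - 2"
  shows "2 * phi n k = split_arc_count n M k"
  using phi_eq endpoints_lt[OF assms] by (auto simp: arc_max_def)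

lemma phi_small_odd:
  assumes "odd n" "n \<le> 6 * k - 5"
  shows "real (phi n k) = (3 * real n ^ 2 - 12 * real n + 17) / 8 + real k"
proof -
  have nM: "n = 2 * M + 3" using assms(1) n unfolding M by presburger
  have "2 * phi n k = (M + 2) * (M + 1) + 2 * (M * M + k)"
    using phi_small assms by (simp add: split_arc_count_def nM)
  then have "2 * real (phi n k) = (real M + 2) * (real M + 1) + 2 * (real M * real M + real k)"
    by (metis (no_types, lifting) of_nat_1 of_nat_add of_nat_mult of_nat_numeral)
  then show ?thesis by (simp add: nM power2_eq_square field_simps)
qed

lemma phi_small_even:
  assumes "even n" "n \<le> 6 * k - 2"
  shows "real (phi n k) = (3 * real n ^ 2 - 10 * real n + 8) / 8 + real k"
proof -
  have nM: "n = 2 * M + 2" using assms(1) n unfolding M by presburger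
  have "2 * phi n k = (M + 1) * M + 2 * (M * M + k)"
    using phi_small assms by (simp add: split_arc_count_def nM)
  then have "2 * real (phi n k) = (real M + 1) * real M + 2 * (real M * real M + real k)"
    by (metis (no_types, lifting) of_nat_1 of_nat_add of_nat_mult of_nat_numeral)
  then show ?thesis by (simp add: nM power2_eq_square field_simps)
qed

lemma attained_tie:
  assumes "pair_graph G" "n = 6 * k - 3 \<or> n = 6 * k"
  shows "phi_attained_by n k G \<longleftrightarrow> graph_order G = n \<and>
    (split_like k k (pverts G) (parcs G) \<or> split_like M k (pverts G) (parcs G))"
  using phi_attained_by_iff[OF assms(1)] endpoints_eq[OF assms(2)] by (auto simp: arc_max_def)

lemma attained_large:
  assumes "pair_graph G" "odd n \<and> n \<ge> 6 * k - 1 \<or> even n \<and> n \<ge> 6 * k + 2"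
  shows "phi_attained_by n k G \<longleftrightarrow> graph_order G = n \<and> split_like k k (pverts G) (parcs G)"
  using phi_attained_by_iff[OF assms(1)] endpoints_gt[OF assms(2)] by (auto simp: arc_max_def)

lemma attained_small:
  assumes "pair_graph G" "odd n \<and> n \<le> 6 * k - 5 \<or> even n \<and> n \<le> 6 * k - 2"
  shows "phi_attained_by n k G \<longleftrightarrow> graph_order G = n \<and> split_like M k (pverts G) (parcs G)"
  using phi_attained_by_iff[OF assms(1)] endpoints_lt[OF assms(2)] by (auto simp: arc_max_def)

end

theorem corollary12:
  fixes n k :: nat
  assumes "n \<ge> 1" and "k \<ge> 1" and "n \<ge> 2 * k + 2"
  shows
    "(odd n \<and> n \<ge> 6 * k - 3 \<or> even n \<and> n \<ge> 6 * k \<longrightarrow>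
        phi n k = ((n - k - 1) choose 2) + k * (k + 1)) \<and>
     (odd n \<and> 2 * k + 3 \<le> n \<and> n \<le> 6 * k - 5 \<longrightarrow>
        real (phi n k) = (3 * real n ^ 2 - 12 * real n + 17) / 8 + real k) \<and>
     (even n \<and> 2 * k + 2 \<le> n \<and> n \<le> 6 * k - 2 \<longrightarrow>
        real (phi n k) = (3 * real n ^ 2 - 10 * real n + 8) / 8 + real k) \<and>
     (n = 6 * k - 3 \<longrightarrow>
        (\<forall>G :: 'a pair_pre_digraph. pair_graph G \<longrightarrow>
          (phi_attained_by n k G \<longleftrightarrow> graph_iso G (split_clique_graph n k) \<or> (\<exists>H \<in> H1 n k. graph_iso G H)))) \<and>
     (n = 6 * k \<longrightarrow>
        (\<forall>G :: 'a pair_pre_digraph. pair_graph G \<longrightarrow>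
          (phi_attained_by n k G \<longleftrightarrow> graph_iso G (split_clique_graph n k) \<or> (\<exists>H \<in> H2 n k. graph_iso G H)))) \<and>
     (odd n \<and> n \<ge> 6 * k - 1 \<or> even n \<and> n \<ge> 6 * k + 2 \<longrightarrow>
        (\<forall>G :: 'a pair_pre_digraph. pair_graph G \<longrightarrow>
          (phi_attained_by n k G \<longleftrightarrow> graph_iso G (split_clique_graph n k)))) \<and>
     (odd n \<and> 2 * k + 3 \<le> n \<and> n \<le> 6 * k - 5 \<longrightarrow>
        (\<forall>G :: 'a pair_pre_digraph. pair_graph G \<longrightarrow>
          (phi_attained_by n k G \<longleftrightarrow> (\<exists>H \<in> H1 n k. graph_iso G H)))) \<and>
     (even n \<and> 2 * k + 2 \<le> n \<and> n \<le> 6 * k - 2 \<longrightarrow>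
        (\<forall>G :: 'a pair_pre_digraph. pair_graph G \<longrightarrow>
          (phi_attained_by n k G \<longleftrightarrow> (\<exists>H \<in> H2 n k. graph_iso G H))))"
proof -
  interpret extremal_problem n k "(n - 2) div 2" by unfold_locales (use assms in auto)
  have tie1: "phi_attained_by n k G \<longleftrightarrow>
      graph_iso G (split_clique_graph n k) \<or> (\<exists>H\<in>H1 n k. graph_iso G H)"
    if "n = 6 * k - 3" "pair_graph G" for G :: "'a pair_pre_digraph"
  proof -
    have "odd n" using that(1) assms(3) by presburger
    then show ?thesis
      using attained_tie[OF that(2)] graph_iso_split_clique_iff[OF that(2)] graph_iso_H1_iff[OF that(2)]
        that(1) by blast
  qed
  have tie2: "phi_attained_by n k G \<longleftrightarrow>
      graph_iso G (split_clique_graph n k) \<or> (\<exists>H\<in>H2 n k. graph_iso G H)"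
    if "n = 6 * k" "pair_graph G" for G :: "'a pair_pre_digraph"
  proof -
    have "even n" using that(1) by simp
    then show ?thesis
      using attained_tie[OF that(2)] graph_iso_split_clique_iff[OF that(2)] graph_iso_H2_iff[OF that(2)]
        that(1) by blast
  qed
  have large: "phi_attained_by n k G \<longleftrightarrow> graph_iso G (split_clique_graph n k)"
    if "odd n \<and> n \<ge> 6 * k - 1 \<or> even n \<and> n \<ge> 6 * k + 2" "pair_graph G"
    for G :: "'a pair_pre_digraph"
    using attained_large[OF that(2,1)] graph_iso_split_clique_iff[OF that(2)] by blast
  have small_odd: "phi_attained_by n k G \<longleftrightarrow> (\<exists>H\<in>H1 n k. graph_iso G H)"
    if "odd n" "n \<le> 6 * k - 5" "pair_graph G" for G :: "'a pair_pre_digraph"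
    using attained_small[OF that(3)] graph_iso_H1_iff[OF that(3,1)] that by blast
  have small_even: "phi_attained_by n k G \<longleftrightarrow> (\<exists>H\<in>H2 n k. graph_iso G H)"
    if "even n" "n \<le> 6 * k - 2" "pair_graph G" for G :: "'a pair_pre_digraph"
    using attained_small[OF that(3)] graph_iso_H2_iff[OF that(3,1)] that by blast
  show ?thesis
    by (intro conjI impI allI;
      (elim conjE)?; (rule phi_large phi_small_odd phi_small_even tie1 tie2 large small_odd small_even;
        assumption))
qed

end
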